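(* Fix an index $p$, $1<p<\infty$, and let $\phi$ be a non-trivial weight on $\mathbb R_+=(0,\infty)$. Take $\rho=\rho_{p,\phi}$ and, for $s\in\mathbb R_+$, set $$h_\rho(s):=\sup_f\frac{\rho\left(f(\tfrac{\cdot}{s})\right)}{\rho(f)}=\sup_f\frac{\rho\left(f^*(\tfrac{\cdot}{s})\right)}{\rho(f^* )},$$ the suprema being over $0\neq f\in\mathfrak M_+(\mathbb R_+)$ with $\rho(f)<\infty$. Then $$h_\rho(s)\approx\sup_{t\in\mathbb R_+}\left[\frac{\int_0^{st}\phi(y)\,dy+s^pt^p\int_{st}^\infty\phi(y)y^{-p}\,dy}{\int_0^t\phi(y)\,dy+t^p\int_t^\infty\phi(y)y^{-p}\,dy}\right]^{1/p},\qquad s\in\mathbb R_+,$$ that is, each side is at most a constant multiple of the other, with a constant independent of $s$.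
   Context: $\mathfrak M_+(\mathbb R_+)$ is the set of nonnegative Lebesgue measurable functions on $\mathbb R_+=(0,\infty)$. For such $f$, $f^*(t):=\inf\{\lambda>0:|\{x\in\mathbb R_+:f(x)>\lambda\}|\le t\}$ is the decreasing rearrangement and $f^{**}(t):=t^{-1}\int_0^tf^*(s)\,ds$, $t>0$. The function $f(\tfrac{\cdot}{s})$ is $t\mapsto f(t/s)$. A weight on $\mathbb R_+$ is a positive locally integrable function, integrable on $(0,t)$ for every finite $t$. The norm is $\rho_{p,\phi}(f):=\left[\int_0^\infty f^{**}(t)^p\phi(t)\,dt\right]^{1/p}$. The weight $\phi$ is non-trivial if $\int_1^\infty\phi(t)t^{-p}\,dt<\infty$ and $\int_0^c\phi(t)t^{-p}\,dt=\infty$ for all $c\in(0,\infty)$. *)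

theory Defs
  imports "HOL-Analysis.Analysis"
begin

text \<open>
  Functions on the half-line are functions on \<^typ>\<open>real\<close> of which only the values on
  \<open>{0<..}\<close> matter; nonnegative functions, which may take the value \<open>\<infinity>\<close>, are
  \<^typ>\<open>ennreal\<close>-valued.
\<close>

text \<open>The power \<open>x\<^sup>p\<close> of an extended nonnegative real, meant for exponents \<open>p > 0\<close>, so that
  \<open>\<infinity>\<^sup>p = \<infinity>\<close>.\<close>
definition epow :: "ennreal \<Rightarrow> real \<Rightarrow> ennreal" where
  "epow x p = (if x = \<infinity> then \<infinity> else ennreal (enn2real x powr p))"

definition M_plus :: "(real \<Rightarrow> ennreal) set" where
  "M_plus = borel_measurable (restrict_space lebesgue {0<..})"

text \<open>The infimum over the empty set is \<open>\<infinity>\<close>.\<close>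
definition rearr :: "(real \<Rightarrow> ennreal) \<Rightarrow> real \<Rightarrow> ennreal" where
  "rearr f t = (INF l\<in>{l::real. 0 < l \<and>
     emeasure lebesgue {x\<in>{0<..}. f x > ennreal l} \<le> ennreal t}. ennreal l)"

definition maximal_rearr :: "(real \<Rightarrow> ennreal) \<Rightarrow> real \<Rightarrow> ennreal" where
  "maximal_rearr f t = (\<integral>\<^sup>+s\<in>{0<..<t}. rearr f s \<partial>lebesgue) / ennreal t"

definition rho :: "real \<Rightarrow> (real \<Rightarrow> real) \<Rightarrow> (real \<Rightarrow> ennreal) \<Rightarrow> ennreal" where
  "rho p \<phi> f =
     epow (\<integral>\<^sup>+t\<in>{0<..}. epow (maximal_rearr f t) p * ennreal (\<phi> t) \<partial>lebesgue) (1 / p)"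

text \<open>Integrability on every \<open>(0, t)\<close> subsumes local integrability on \<open>(0, \<infinity>)\<close>, and
  measurability there.\<close>
definition weight :: "(real \<Rightarrow> real) \<Rightarrow> bool" where
  "weight \<phi> \<longleftrightarrow> (\<forall>t>0. \<phi> t > 0) \<and> (\<forall>t>0. set_integrable lebesgue {0<..<t} \<phi>)"

definition nontrivial_weight :: "real \<Rightarrow> (real \<Rightarrow> real) \<Rightarrow> bool" where
  "nontrivial_weight p \<phi> \<longleftrightarrow> weight \<phi> \<and>
     (\<integral>\<^sup>+t\<in>{1<..}. ennreal (\<phi> t * t powr (- p)) \<partial>lebesgue) < \<infinity> \<and>
     (\<forall>c>0. (\<integral>\<^sup>+t\<in>{0<..<c}. ennreal (\<phi> t * t powr (- p)) \<partial>lebesgue) = \<infinity>)"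

text \<open>As usual, \<open>f \<noteq> 0\<close> is understood almost everywhere.\<close>
definition admissible :: "((real \<Rightarrow> ennreal) \<Rightarrow> ennreal) \<Rightarrow> (real \<Rightarrow> ennreal) set" where
  "admissible \<rho> = {f \<in> M_plus. \<not> (AE x in lebesgue. 0 < x \<longrightarrow> f x = 0) \<and> \<rho> f < \<infinity>}"

definition dilation_fn :: "((real \<Rightarrow> ennreal) \<Rightarrow> ennreal) \<Rightarrow> real \<Rightarrow> ennreal" where
  "dilation_fn \<rho> s = (SUP f\<in>admissible \<rho>. \<rho> (\<lambda>t. f (t / s)) / \<rho> f)"

definition weight_quotient :: "real \<Rightarrow> (real \<Rightarrow> real) \<Rightarrow> real \<Rightarrow> real \<Rightarrow> ennreal" where
  "weight_quotient p \<phi> s t =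
     ((\<integral>\<^sup>+y\<in>{0<..<s * t}. ennreal (\<phi> y) \<partial>lebesgue) +
        ennreal (s powr p * t powr p) *
        (\<integral>\<^sup>+y\<in>{s * t<..}. ennreal (\<phi> y * y powr (- p)) \<partial>lebesgue)) /
     ((\<integral>\<^sup>+y\<in>{0<..<t}. ennreal (\<phi> y) \<partial>lebesgue) +
        ennreal (t powr p) *
        (\<integral>\<^sup>+y\<in>{t<..}. ennreal (\<phi> y * y powr (- p)) \<partial>lebesgue))"

end

theory Submission
  imports Defs
begin

text \<open>
  Write \<open>\<chi>\<^sub>t\<close> for the characteristic function of \<open>(0, t)\<close> and \<open>Mf = f\<^sup>*\<^sup>*\<close>. Since
  \<open>M\<chi>\<^sub>t(y) = min(1, t/y)\<close>, the expression inside the supremum is \<open>\<rho>(\<chi>\<^bsub>st\<^esub>)/\<rho>(\<chi>\<^sub>t)\<close>, so that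
  characteristic functions give one of the two inequalities with constant 1. For the other one,
  Fatou's lemma allows \<open>f\<^sup>*\<close> to be replaced by a finite sum \<open>\<Sum> c\<^sub>i \<chi>\<^bsub>m\<^sub>i\<^esub>\<close>, and then \<open>Mf\<close> is
  comparable to \<open>A(t) = \<Sum> c\<^sub>i m\<^sub>i/(t + m\<^sub>i)\<close>. With \<open>B = -t A'\<close> and \<open>D = (t A)' = A - B\<close>, the function
  \<open>A\<^sup>p\<close> is comparable to \<open>\<integral> min(1, y/t)\<^sup>p u(y) dy\<close> where \<open>u(y) = A(y)\<^bsup>p-2\<^esup> B(y) D(y)/y\<close>. By Tonelli's
  theorem this turns \<open>\<integral> A(t/s)\<^sup>p \<phi>(t) dt\<close> into \<open>\<integral> \<rho>(\<chi>\<^bsub>sy\<^esub>)\<^sup>p u(y) dy\<close>, in which the integrand can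
  be compared with its value for \<open>s = 1\<close>.
\<close>

subsection \<open>Integrals bounded by means of a primitive\<close>

text \<open>In the gauge integral the fundamental theorem holds for every derivative, so the
  comparison with \<open>u\<close> is made there. Only \<open>u\<close>, continuous and nonnegative,
  is carried over to the Lebesgue integral.\<close>

lemma nn_integral_FTC_sandwich:
  fixes u X X' :: "real \<Rightarrow> real"
  assumes u: "continuous_on {a..b} u" "\<And>t. t \<in> {a..b} \<Longrightarrow> 0 \<le> u t"
    and X: "\<And>t. t \<in> {a..b} \<Longrightarrow> (X has_real_derivative X' t) (at t)"
    and ab: "a \<le> b"
  shows "(\<And>t. t \<in> {a..b} \<Longrightarrow> X' t \<le> u t) \<Longrightarrow>
           ennreal (X b - X a) \<le> (\<integral>\<^sup>+t\<in>{a..b}. ennreal (u t) \<partial>lborel)"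
    and "(\<And>t. t \<in> {a..b} \<Longrightarrow> u t \<le> X' t) \<Longrightarrow>
           (\<integral>\<^sup>+t\<in>{a..b}. ennreal (u t) \<partial>lborel) \<le> ennreal (X b - X a)"
proof -
  have I: "(X' has_integral X b - X a) {a..b}"
    using ab X by (intro fundamental_theorem_of_calculus)
      (auto simp: has_real_derivative_iff_has_vector_derivative[symmetric] intro: DERIV_subset)
  have U: "(u has_integral integral {a..b} u) {a..b}"
    using u(1) by (simp add: integrable_continuous_real integrable_integral)
  have eq: "(\<integral>\<^sup>+t\<in>{a..b}. ennreal (u t) \<partial>lborel) = ennreal (integral {a..b} u)"
    using u(2) U by (rule nn_integral_has_integral_lebesgue')
  show "ennreal (X b - X a) \<le> (\<integral>\<^sup>+t\<in>{a..b}. ennreal (u t) \<partial>lborel)"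
    if "\<And>t. t \<in> {a..b} \<Longrightarrow> X' t \<le> u t"
    unfolding eq using has_integral_le[OF I U] that by (intro ennreal_leI) auto
  show "(\<integral>\<^sup>+t\<in>{a..b}. ennreal (u t) \<partial>lborel) \<le> ennreal (X b - X a)"
    if "\<And>t. t \<in> {a..b} \<Longrightarrow> u t \<le> X' t"
    unfolding eq using has_integral_le[OF U I] that by (intro ennreal_leI) auto
qed

text \<open>As \<open>a\<close> tends to 0 from the right, the bound \<open>X b - X a\<close> on
  \<open>{a..b}\<close> tends to \<open>X b\<close>, while these integrals all stay below the one
  over the open interval.\<close>

lemma nn_integral_Ioo_lower:
  fixes u X X' :: "real \<Rightarrow> real"
  assumes u: "continuous_on {0<..} u" "\<And>t. 0 < t \<Longrightarrow> 0 \<le> u t"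
    and X: "\<And>t. 0 < t \<Longrightarrow> (X has_real_derivative X' t) (at t)"
    and le: "\<And>t. 0 < t \<Longrightarrow> X' t \<le> u t" and lim: "(X \<longlongrightarrow> 0) (at_right 0)" and b: "0 < b"
  shows "ennreal (X b) \<le> (\<integral>\<^sup>+t\<in>{0<..<b}. ennreal (u t) \<partial>lborel)"
proof -
  have "((\<lambda>a. ennreal (X b - X a)) \<longlongrightarrow> ennreal (X b - 0)) (at_right 0)"
    by (intro tendsto_ennrealI tendsto_intros lim)
  moreover have "eventually (\<lambda>a. a \<in> {0<..<b}) (at_right 0)"
    using b by (rule eventually_at_right_real)
  then have "eventually (\<lambda>a. ennreal (X b - X a) \<le> (\<integral>\<^sup>+t\<in>{0<..<b}. ennreal (u t) \<partial>lborel)) (at_right 0)"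
  proof eventually_elim
    case (elim a)
    have "ennreal (X b - X a) \<le> (\<integral>\<^sup>+t\<in>{a..b}. ennreal (u t) \<partial>lborel)"
      using elim by (intro nn_integral_FTC_sandwich(1)[where X' = X'] continuous_on_subset[OF u(1)])
        (auto intro!: u X le)
    also have "\<dots> \<le> (\<integral>\<^sup>+t\<in>{0<..<b}. ennreal (u t) \<partial>lborel)"
    proof (rule nn_integral_mono_AE)
      \<comment> \<open>The closed interval contains \<open>b\<close> and the open one does not; the
        inclusion holds off this null set.\<close>
      show "AE t in lborel. ennreal (u t) * indicator {a..b} t \<le> ennreal (u t) * indicator {0<..<b} t"
        using AE_lborel_singleton[of b] by eventually_elim (use elim in \<open>auto simp: indicator_def\<close>)
    qed
    finally show ?case .
  qed
  ultimately show ?thesis by (auto intro: tendsto_upperbound)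
qed

lemma nn_integral_Ioi_lower:
  fixes u X X' :: "real \<Rightarrow> real"
  assumes u: "continuous_on {0<..} u" "\<And>t. 0 < t \<Longrightarrow> 0 \<le> u t"
    and X: "\<And>t. 0 < t \<Longrightarrow> (X has_real_derivative X' t) (at t)"
    and le: "\<And>t. 0 < t \<Longrightarrow> - u t \<le> X' t" and lim: "(X \<longlongrightarrow> 0) at_top" and b: "0 < b"
  shows "ennreal (X b) \<le> (\<integral>\<^sup>+t\<in>{b<..}. ennreal (u t) \<partial>lborel)"
proof -
  have le': "- X' t \<le> u t" if "0 < t" for t using le[OF that] by linarith
  have "((\<lambda>a. ennreal (- X a - - X b)) \<longlongrightarrow> ennreal (- 0 - - X b)) at_top"
    by (intro tendsto_ennrealI tendsto_intros lim)
  moreover have "eventually (\<lambda>a. a > b) at_top" by (rule eventually_gt_at_top)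
  then have "eventually (\<lambda>a. ennreal (- X a - - X b) \<le> (\<integral>\<^sup>+t\<in>{b<..}. ennreal (u t) \<partial>lborel)) at_top"
  proof eventually_elim
    case (elim a)
    have "ennreal (- X a - - X b) \<le> (\<integral>\<^sup>+t\<in>{b..a}. ennreal (u t) \<partial>lborel)"
      using elim b
      by (intro nn_integral_FTC_sandwich(1)[where X' = "\<lambda>t. - X' t" and X = "\<lambda>t. - X t"]
           continuous_on_subset[OF u(1)] DERIV_minus X u(2))
        (auto intro!: le')
    also have "\<dots> \<le> (\<integral>\<^sup>+t\<in>{b<..}. ennreal (u t) \<partial>lborel)"
    proof (rule nn_integral_mono_AE)
      show "AE t in lborel. ennreal (u t) * indicator {b..a} t \<le> ennreal (u t) * indicator {b<..} t"
        using AE_lborel_singleton[of b] by eventually_elim (use elim in \<open>auto simp: indicator_def\<close>)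
    qed
    finally show ?case .
  qed
  ultimately show ?thesis by (auto intro: tendsto_upperbound)
qed

text \<open>Monotone convergence, obtained as continuity from below of the measure with density
  \<open>f\<close>.\<close>

lemma nn_integral_exhaust_le:
  fixes f :: "real \<Rightarrow> ennreal" and A :: "nat \<Rightarrow> real set"
  assumes [measurable]: "f \<in> borel_measurable borel" "\<And>n. A n \<in> sets borel"
    and "incseq A" and le: "\<And>n. (\<integral>\<^sup>+t\<in>A n. f t \<partial>lborel) \<le> C"
  shows "(\<integral>\<^sup>+t\<in>(\<Union>n. A n). f t \<partial>lborel) \<le> C"
proof -
  have "(\<integral>\<^sup>+t\<in>(\<Union>n. A n). f t \<partial>lborel) = (SUP n. \<integral>\<^sup>+t\<in>A n. f t \<partial>lborel)"
    using SUP_emeasure_incseq[of A "density lborel f"] \<open>incseq A\<close>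
    by (simp add: emeasure_density image_subset_iff)
  then show ?thesis using le by (auto intro: SUP_least)
qed

text \<open>At the lower end \<open>X a\<close> enters with a minus sign and is dropped by
  nonnegativity, so the bound on \<open>{b/(n+1)..b}\<close> is uniform in \<open>n\<close>.\<close>

lemma nn_integral_Ioo_upper:
  fixes u X X' :: "real \<Rightarrow> real"
  assumes u: "continuous_on {0<..} u" "\<And>t. 0 < t \<Longrightarrow> 0 \<le> u t"
    and X: "\<And>t. 0 < t \<Longrightarrow> (X has_real_derivative X' t) (at t)"
    and le: "\<And>t. 0 < t \<Longrightarrow> u t \<le> X' t" and X0: "\<And>t. 0 < t \<Longrightarrow> 0 \<le> X t" and b: "0 < b"
  shows "(\<integral>\<^sup>+t\<in>{0<..<b}. ennreal (u t) \<partial>lborel) \<le> ennreal (X b)"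
proof -
  \<comment> \<open>Continuity is given on the half-line; the cut-off yields a Borel function on the
    whole line.\<close>
  have [measurable]: "(\<lambda>t. ennreal (u t * indicator {0<..} t)) \<in> borel_measurable borel"
    using borel_measurable_continuous_on_indicator[OF _ u(1)] by (simp add: mult.commute)
  have un: "{0<..b} = (\<Union>n. {b / real (n + 1)..b})"
  proof safe
    fix x assume x: "x \<in> {0<..b}"
    obtain n where "b / x < real n" using reals_Archimedean2 by blast
    then have "b / real (n + 1) \<le> x" using x by (simp add: field_simps)
    then show "x \<in> (\<Union>n. {b / real (n + 1)..b})" using x by auto
  next
    fix x n assume x: "x \<in> {b / real (n + 1)..b}"
    moreover have "0 < b / real (n + 1)" using b by simp
    ultimately show "x \<in> {0<..b}" by auto
  qed
  have "(\<integral>\<^sup>+t\<in>{0<..<b}. ennreal (u t) \<partial>lborel)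
      \<le> (\<integral>\<^sup>+t\<in>{0<..b}. ennreal (u t * indicator {0<..} t) \<partial>lborel)"
    by (intro nn_integral_mono) (auto simp: indicator_def)
  also have "\<dots> \<le> ennreal (X b)"
    unfolding un
  proof (rule nn_integral_exhaust_le)
    show "incseq (\<lambda>n. {b / real (n + 1)..b})"
      using b by (intro monoI) (auto intro!: divide_left_mono dest: order_trans[rotated])
    fix n
    define a where "a = b / real (n + 1)"
    have a: "0 < a" "a \<le> b" using b by (auto simp: a_def field_simps)
    have "(\<integral>\<^sup>+t\<in>{a..b}. ennreal (u t * indicator {0<..} t) \<partial>lborel) = (\<integral>\<^sup>+t\<in>{a..b}. ennreal (u t) \<partial>lborel)"
      using a by (intro nn_integral_cong) (auto simp: indicator_def)
    also have "\<dots> \<le> ennreal (X b - X a)"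
      using a by (intro nn_integral_FTC_sandwich(2)[where X' = X'] continuous_on_subset[OF u(1)])
        (auto intro!: u X le)
    also have "\<dots> \<le> ennreal (X b)" using X0[of a] a by (intro ennreal_leI) auto
    finally show "(\<integral>\<^sup>+t\<in>{b / real (n + 1)..b}. ennreal (u t * indicator {0<..} t) \<partial>lborel) \<le> ennreal (X b)"
      unfolding a_def .
  qed auto
  finally show ?thesis .
qed

lemma nn_integral_Ioi_upper:
  fixes u X X' :: "real \<Rightarrow> real"
  assumes u: "continuous_on {0<..} u" "\<And>t. 0 < t \<Longrightarrow> 0 \<le> u t"
    and X: "\<And>t. 0 < t \<Longrightarrow> (X has_real_derivative X' t) (at t)"
    and le: "\<And>t. 0 < t \<Longrightarrow> u t \<le> - X' t" and X0: "\<And>t. 0 < t \<Longrightarrow> 0 \<le> X t" and b: "0 < b"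
  shows "(\<integral>\<^sup>+t\<in>{b<..}. ennreal (u t) \<partial>lborel) \<le> ennreal (X b)"
proof -
  have [measurable]: "(\<lambda>t. ennreal (u t * indicator {0<..} t)) \<in> borel_measurable borel"
    using borel_measurable_continuous_on_indicator[OF _ u(1)] by (simp add: mult.commute)
  have un: "{b..} = (\<Union>n. {b..b + real n})"
    using real_arch_simple[of "_ - b"] by (auto simp: diff_le_eq add.commute)
  have "(\<integral>\<^sup>+t\<in>{b<..}. ennreal (u t) \<partial>lborel)
      \<le> (\<integral>\<^sup>+t\<in>{b..}. ennreal (u t * indicator {0<..} t) \<partial>lborel)"
    using b by (intro nn_integral_mono) (auto simp: indicator_def)
  also have "\<dots> \<le> ennreal (X b)"
    unfolding un
  proof (rule nn_integral_exhaust_le)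
    show "incseq (\<lambda>n. {b..b + real n})" by (auto intro!: monoI)
    fix n
    define a where "a = b + real n"
    have a: "b \<le> a" by (auto simp: a_def)
    have "(\<integral>\<^sup>+t\<in>{b..a}. ennreal (u t * indicator {0<..} t) \<partial>lborel) = (\<integral>\<^sup>+t\<in>{b..a}. ennreal (u t) \<partial>lborel)"
      using b by (intro nn_integral_cong) (auto simp: indicator_def)
    also have "\<dots> \<le> ennreal (- X a - - X b)"
      using a b by (intro nn_integral_FTC_sandwich(2)[where X' = "\<lambda>t. - X' t" and X = "\<lambda>t. - X t"]
          continuous_on_subset[OF u(1)] DERIV_minus X u(2) le) auto
    also have "\<dots> \<le> ennreal (X b)" using X0[of a] a b by (intro ennreal_leI) auto
    finally show "(\<integral>\<^sup>+t\<in>{b..b + real n}. ennreal (u t * indicator {0<..} t) \<partial>lborel) \<le> ennreal (X b)"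
      unfolding a_def .
  qed auto
  finally show ?thesis .
qed

subsection \<open>An integral representation of finite sums\<close>

text \<open>The data stand for the nonincreasing step function that adds \<open>c i\<close> on each
  \<open>(0, m i)\<close>; its mean over \<open>(0, t)\<close> is the sum of the
  \<open>c i * min 1 (m i / t)\<close>. Strict positivity and nonemptiness keep \<open>A\<close>
  positive, so that its powers can be differentiated.\<close>

locale step_sum =
  fixes I :: "'i set" and c m :: "'i \<Rightarrow> real" and p :: real
  assumes finI: "finite I" and neI: "I \<noteq> {}"
    and c_pos: "\<And>i. i \<in> I \<Longrightarrow> 0 < c i" and m_pos: "\<And>i. i \<in> I \<Longrightarrow> 0 < m i"
    and p_gt_1: "1 < p"
begin

text \<open>The smooth \<open>m / (t + m)\<close> replaces \<open>min 1 (m / t)\<close>; it lies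
  between half of it and the whole.\<close>

definition A :: "real \<Rightarrow> real" where "A t = (\<Sum>i\<in>I. c i * m i / (t + m i))"
definition B :: "real \<Rightarrow> real" where "B t = (\<Sum>i\<in>I. c i * m i * t / (t + m i)\<^sup>2)"
definition D :: "real \<Rightarrow> real" where "D t = (\<Sum>i\<in>I. c i * (m i)\<^sup>2 / (t + m i)\<^sup>2)"
text \<open>\<open>E\<close> carries the second derivatives: on the half-line it is both
  \<open>- t D' / 2\<close> and \<open>(t B)' / 2\<close>.\<close>

definition E :: "real \<Rightarrow> real" where "E t = (\<Sum>i\<in>I. c i * (m i)\<^sup>2 * t / (t + m i) ^ 3)"
definition u :: "real \<Rightarrow> real" where "u t = A t powr (p - 2) * B t * D t / t"

section \<open>Pointwise relations between \<open>A\<close>, \<open>B\<close>, \<open>D\<close> and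
  \<open>E\<close>\<close>

lemma tm_pos: "0 < t \<Longrightarrow> i \<in> I \<Longrightarrow> 0 < t + m i"
  using m_pos[of i] by simp

lemma A_pos: "0 < t \<Longrightarrow> 0 < A t"
  unfolding A_def using finI neI c_pos m_pos tm_pos by (intro sum_pos) auto

lemma B_nonneg: "0 < t \<Longrightarrow> 0 \<le> B t"
  unfolding B_def using c_pos m_pos
  by (intro sum_nonneg divide_nonneg_nonneg mult_nonneg_nonneg) (auto intro: less_imp_le)

lemma D_nonneg: "0 < t \<Longrightarrow> 0 \<le> D t"
  unfolding D_def using c_pos m_pos
  by (intro sum_nonneg divide_nonneg_nonneg mult_nonneg_nonneg) (auto intro: less_imp_le)

lemma A_eq: "0 < t \<Longrightarrow> A t = B t + D t"
  unfolding A_def B_def D_def sum.distrib[symmetric]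
proof (rule sum.cong[OF refl])
  fix i assume "0 < t" "i \<in> I"
  then have "t + m i \<noteq> 0" using tm_pos[of t i] by simp
  then show "c i * m i / (t + m i) = c i * m i * t / (t + m i)\<^sup>2 + c i * (m i)\<^sup>2 / (t + m i)\<^sup>2"
    by (simp add: divide_simps) (simp add: power2_eq_square algebra_simps)
qed

text \<open>With weights \<open>W i = c i * m i / (t + m i)\<close> and values
  \<open>x i = m i / (t + m i)\<close>, the sums of \<open>W\<close>, \<open>W x\<close> and
  \<open>W x^2\<close> are \<open>A\<close>, \<open>D\<close> and \<open>S\<close>. Cauchy-Schwarz
  gives \<open>D^2 \<le> A S\<close>; as \<open>E = D - S\<close>, it follows that
  \<open>A E \<le> A D - D^2 = B D\<close>. This lets the terms with \<open>E\<close> in later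
  derivatives be absorbed into \<open>u\<close>.\<close>

lemma AE_le_BD:
  assumes t: "0 < t" shows "A t * E t \<le> B t * D t"
proof -
  define S where "S = (\<Sum>i\<in>I. c i * (m i) ^ 3 / (t + m i) ^ 3)"
  define W where "W = (\<lambda>i. c i * m i / (t + m i))"
  have W: "0 \<le> W i" if "i \<in> I" for i
    unfolding W_def using c_pos[OF that] m_pos[OF that] t by simp
  have "(\<Sum>i\<in>I. sqrt (W i) * (sqrt (W i) * (m i / (t + m i))))\<^sup>2
      \<le> (\<Sum>i\<in>I. (sqrt (W i))\<^sup>2) * (\<Sum>i\<in>I. (sqrt (W i) * (m i / (t + m i)))\<^sup>2)"
    by (rule Cauchy_Schwarz_ineq_sum)
  also have "(\<Sum>i\<in>I. sqrt (W i) * (sqrt (W i) * (m i / (t + m i)))) = D t"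
    unfolding D_def
  proof (rule sum.cong[OF refl])
    fix i assume "i \<in> I"
    then have "sqrt (W i) * (sqrt (W i) * (m i / (t + m i))) = W i * (m i / (t + m i))"
      using W[of i] by (simp add: mult.assoc[symmetric] del: times_divide_eq_right)
    then show "sqrt (W i) * (sqrt (W i) * (m i / (t + m i))) = c i * (m i)\<^sup>2 / (t + m i)\<^sup>2"
      by (simp add: W_def power2_eq_square)
  qed
  also have "(\<Sum>i\<in>I. (sqrt (W i))\<^sup>2) = A t"
    unfolding A_def by (rule sum.cong) (use W in \<open>auto simp: W_def\<close>)
  also have "(\<Sum>i\<in>I. (sqrt (W i) * (m i / (t + m i)))\<^sup>2) = S"
    unfolding S_def
  proof (rule sum.cong[OF refl])
    fix i assume "i \<in> I"
    then have "(sqrt (W i) * (m i / (t + m i)))\<^sup>2 = W i * (m i / (t + m i))\<^sup>2"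
      using W[of i] by (simp only: power_mult_distrib real_sqrt_pow2)
    then show "(sqrt (W i) * (m i / (t + m i)))\<^sup>2 = c i * m i ^ 3 / (t + m i) ^ 3"
      by (simp add: W_def power2_eq_square power3_eq_cube mult.assoc)
  qed
  finally have CS: "(D t)\<^sup>2 \<le> A t * S" .
  have "E t = D t - S"
    unfolding E_def D_def S_def sum_subtractf[symmetric]
  proof (rule sum.cong[OF refl])
    fix i assume "i \<in> I"
    then have "t + m i \<noteq> 0" using tm_pos[of t i] t by simp
    then have "c i * (m i)\<^sup>2 / (t + m i)\<^sup>2 = c i * (m i)\<^sup>2 * (t + m i) / (t + m i) ^ 3"
      by (simp add: power2_eq_square power3_eq_cube)
    then show "c i * (m i)\<^sup>2 * t / (t + m i) ^ 3 = c i * (m i)\<^sup>2 / (t + m i)\<^sup>2 - c i * m i ^ 3 / (t + m i) ^ 3"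
      by (simp add: diff_divide_distrib[symmetric]) (simp add: power2_eq_square power3_eq_cube algebra_simps)
  qed
  then have "A t * E t = A t * D t - A t * S" by (simp only: right_diff_distrib)
  also have "\<dots> \<le> A t * D t - (D t)\<^sup>2" using CS by simp
  also have "\<dots> = B t * D t" using A_eq[OF t] by (simp add: power2_eq_square algebra_simps)
  finally show ?thesis .
qed

section \<open>Derivatives of \<open>A\<close>, \<open>D\<close>, \<open>t A\<close> and
  \<open>t B\<close>\<close>

lemma deriv_A:
  assumes t: "0 < t" shows "(A has_real_derivative - B t / t) (at t)"
proof -
  have "(A has_real_derivative (\<Sum>i\<in>I. - (c i * m i / (t + m i)\<^sup>2))) (at t)"
    unfolding A_def[abs_def] using t tm_pos
    by (auto intro!: derivative_eq_intros sum.cong simp: power2_eq_square less_imp_neq[symmetric])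
  also have "(\<Sum>i\<in>I. - (c i * m i / (t + m i)\<^sup>2)) = - B t / t"
    unfolding B_def sum_negf sum_divide_distrib minus_divide_left[symmetric] using t
    by (intro arg_cong[where f = uminus] sum.cong) auto
  finally show ?thesis .
qed

lemma deriv_D:
  assumes t: "0 < t" shows "(D has_real_derivative - 2 * E t / t) (at t)"
proof -
  have "(D has_real_derivative (\<Sum>i\<in>I. - 2 * (c i * (m i)\<^sup>2 / (t + m i) ^ 3))) (at t)"
    unfolding D_def[abs_def]
  proof (rule DERIV_sum)
    fix i assume "i \<in> I"
    then have "t + m i \<noteq> 0" using tm_pos[of t i] t by simp
    then show "((\<lambda>t. c i * (m i)\<^sup>2 / (t + m i)\<^sup>2) has_real_derivative - 2 * (c i * (m i)\<^sup>2 / (t + m i) ^ 3)) (at t)"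
      by (auto intro!: derivative_eq_intros)
        (simp add: frac_eq_eq, simp add: eval_nat_numeral algebra_simps)
  qed
  also have "(\<Sum>i\<in>I. - 2 * (c i * (m i)\<^sup>2 / (t + m i) ^ 3)) = - 2 * E t / t"
    unfolding E_def sum_distrib_left sum_divide_distrib using t
    by (intro sum.cong) auto
  finally show ?thesis .
qed

lemma deriv_tA:
  assumes t: "0 < t" shows "((\<lambda>t. t * A t) has_real_derivative D t) (at t)"
  using t A_eq[OF t] by (auto intro!: derivative_eq_intros deriv_A)

lemma deriv_tB:
  assumes t: "0 < t" shows "((\<lambda>t. t * B t) has_real_derivative 2 * E t) (at t)"
proof -
  \<comment> \<open>\<open>B\<close> is known to equal \<open>A - D\<close> at positive arguments,
    so \<open>t (A - D)\<close> is differentiated and the result transferred through equality near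
    \<open>t\<close>.\<close>
  have "((\<lambda>t. t * (A t - D t)) has_real_derivative (A t - D t) + t * (- B t / t + 2 * E t / t)) (at t)"
    by (auto intro!: derivative_eq_intros deriv_A deriv_D t)
  then have "((\<lambda>t. t * (A t - D t)) has_real_derivative 2 * E t) (at t)"
    using t A_eq[OF t] by (simp add: algebra_simps)
  then show ?thesis
    by (rule DERIV_cong_ev[OF refl _ refl, THEN iffD1, rotated])
      (use eventually_nhds_in_open[of "{0<..}" t] t A_eq in \<open>auto elim!: eventually_mono\<close>)
qed

lemma u_nonneg: "0 < t \<Longrightarrow> 0 \<le> u t"
  unfolding u_def using B_nonneg D_nonneg by simp

lemma continuous_u: "continuous_on {0<..} u"
proof -
  have ne: "t + m i \<noteq> 0" "A t \<noteq> 0" if "0 < t" "i \<in> I" for t i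
    using tm_pos[OF that] A_pos[OF that(1)] by auto
  have "continuous_on {0<..} A" "continuous_on {0<..} B" "continuous_on {0<..} D"
    unfolding A_def[abs_def] B_def[abs_def] D_def[abs_def]
    using ne by (auto intro!: continuous_intros)
  then show ?thesis unfolding u_def[abs_def] using ne neI by (auto intro!: continuous_intros)
qed

lemma continuous_tu: "continuous_on {0<..} (\<lambda>t. t powr p * u t)"
  by (intro continuous_intros continuous_u) auto

section \<open>Bounds for the integrals of \<open>u\<close> beyond \<open>t\<close> and of
  \<open>y powr p * u y\<close> below \<open>t\<close>\<close>

lemma powr_split: "0 < (x::real) \<Longrightarrow> x powr (p - 1) = x * x powr (p - 2)"
  using powr_mult_base[of x "p - 2"] by (simp add: algebra_simps)

lemma powr_split': "0 < (x::real) \<Longrightarrow> x powr p = x * x * x powr (p - 2)"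
  using powr_mult_base[of x "p - 1"] powr_split[of x] by simp

text \<open>By \<open>D \<le> A\<close> the integrand is at most
  \<open>A powr (p - 1) * B / t\<close>, which is minus the derivative of
  \<open>A powr p / p\<close>.\<close>

lemma upper_Ioi:
  assumes t: "0 < t"
  shows "(\<integral>\<^sup>+y\<in>{t<..}. ennreal (u y) \<partial>lborel) \<le> ennreal (A t powr p / p)"
proof (rule nn_integral_Ioi_upper[OF continuous_u u_nonneg _ _ _ t])
  fix t :: real assume t: "0 < t"
  show "((\<lambda>t. A t powr p / p) has_real_derivative (p * A t powr (p - of_nat 1) * (- B t / t)) / p) (at t)"
    by (intro DERIV_cdivide DERIV_fun_powr deriv_A t A_pos)
  have "A t powr (p - 2) * B t * D t \<le> A t powr (p - 2) * B t * A t"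
    using A_eq[OF t] B_nonneg[OF t] by (intro mult_left_mono) auto
  then show "u t \<le> - ((p * A t powr (p - of_nat 1) * (- B t / t)) / p)"
    unfolding u_def using p_gt_1 t by (simp add: powr_split[OF A_pos[OF t]] field_simps)
  show "0 \<le> A t powr p / p" using p_gt_1 by simp
qed

text \<open>By \<open>B \<le> A\<close> the integrand is at most
  \<open>(t * A) powr (p - 1) * D\<close>, the derivative of
  \<open>(t * A) powr p / p\<close>.\<close>

lemma upper_Ioo:
  assumes t: "0 < t"
  shows "(\<integral>\<^sup>+y\<in>{0<..<t}. ennreal (y powr p * u y) \<partial>lborel) \<le> ennreal ((t * A t) powr p / p)"
proof (rule nn_integral_Ioo_upper[OF continuous_tu _ _ _ _ t])
  fix t :: real assume t: "0 < t"
  show "((\<lambda>t. (t * A t) powr p / p) has_real_derivative (p * (t * A t) powr (p - of_nat 1) * D t) / p) (at t)"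
    using A_pos[OF t] t by (intro DERIV_cdivide DERIV_fun_powr deriv_tA) auto
  have "t * t powr (p - 2) * A t powr (p - 2) * D t * B t
      \<le> t * t powr (p - 2) * A t powr (p - 2) * D t * A t"
    using A_eq[OF t] D_nonneg[OF t] t by (intro mult_left_mono) auto
  then show "t powr p * u t \<le> (p * (t * A t) powr (p - of_nat 1) * D t) / p"
    unfolding u_def using p_gt_1 t A_pos[OF t]
    by (simp add: powr_split powr_split' powr_mult algebra_simps)
  show "0 \<le> (t * A t) powr p / p" using p_gt_1 by simp
  show "0 \<le> t powr p * u t" using u_nonneg[OF t] by simp
qed

lemma tA_lim: "((\<lambda>t. t * A t) \<longlongrightarrow> 0) (at_right 0)"
proof -
  have "((\<lambda>t. t * A t) \<longlongrightarrow> 0 * A 0) (at_right 0)"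
    unfolding A_def using m_pos less_imp_neq by (fastforce intro!: tendsto_intros)
  then show ?thesis by simp
qed

lemma A_lim: "(A \<longlongrightarrow> 0) at_top"
proof -
  have "(A \<longlongrightarrow> (\<Sum>i\<in>I. 0)) at_top"
    unfolding A_def[abs_def] add.commute[of _ "m _"]
    by (rule tendsto_sum, rule real_tendsto_divide_at_top[OF tendsto_const])
      (rule filterlim_tendsto_add_at_top[OF tendsto_const filterlim_ident])
  then show ?thesis by simp
qed

text \<open>The primitive keeps one factor \<open>D\<close>, so that together with the matching
  bound below \<open>t\<close>, which keeps \<open>B\<close>, it adds up to \<open>A powr p\<close>.
  Its derivative contains \<open>E\<close>, which is removed by
  \<open>A E \<le> B D\<close>.\<close>

lemma lower_Ioi:
  assumes t: "0 < t"
  shows "ennreal (A t powr (p - 1) * D t / (p + 1)) \<le> (\<integral>\<^sup>+y\<in>{t<..}. ennreal (u y) \<partial>lborel)"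
proof (rule nn_integral_Ioi_lower[OF continuous_u u_nonneg _ _ _ t])
  fix t :: real assume t: "0 < t"
  show "((\<lambda>t. A t powr (p - 1) * D t / (p + 1)) has_real_derivative
     (((p - 1) * A t powr (p - 1 - of_nat 1) * (- B t / t)) * D t + (- 2 * E t / t) * A t powr (p - 1)) / (p + 1)) (at t)"
    by (intro DERIV_cdivide DERIV_mult DERIV_fun_powr deriv_A deriv_D t A_pos)
  define X where "X = A t powr (p - 2) * (B t * D t)"
  define Y where "Y = A t powr (p - 2) * (A t * E t)"
  have "Y \<le> X" unfolding X_def Y_def using AE_le_BD[OF t] by (intro mult_left_mono) auto
  \<comment> \<open>The coefficients \<open>p - 1\<close> of \<open>X\<close> and 2 of
    \<open>Y\<close> add up to \<open>p + 1\<close>, the source of this constant.\<close>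
  then have "- ((p + 1) * X / t) / (p + 1) \<le> - (((p - 1) * X + 2 * Y) / t) / (p + 1)"
    using t p_gt_1 by (intro divide_right_mono le_imp_neg_le) (auto simp: algebra_simps)
  moreover have "- ((p + 1) * X / t) / (p + 1) = - u t"
    using p_gt_1 by (simp add: X_def u_def)
  moreover have "((p - 1) * A t powr (p - 1 - of_nat 1) * (- B t / t)) * D t + (- 2 * E t / t) * A t powr (p - 1)
      = - (((p - 1) * X + 2 * Y) / t)"
    unfolding X_def Y_def by (simp add: powr_split[OF A_pos[OF t]] add_divide_distrib mult.assoc mult.left_commute)
  ultimately show "- u t \<le> (((p - 1) * A t powr (p - 1 - of_nat 1) * (- B t / t)) * D t + (- 2 * E t / t) * A t powr (p - 1)) / (p + 1)"
    by simp
next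
  \<comment> \<open>Since \<open>D \<le> A\<close>, the primitive is dominated by
    \<open>A powr p\<close>, so it is enough that the latter tends to 0.\<close>
  have "((\<lambda>t. A t powr p) \<longlongrightarrow> 0) at_top"
  proof (rule tendsto_zero_powrI[OF A_lim tendsto_const])
    show "\<forall>\<^sub>F t in at_top. 0 \<le> A t"
      using eventually_gt_at_top[of 0] by eventually_elim (simp add: A_pos less_imp_le)
  qed (use p_gt_1 in simp)
  then show "((\<lambda>t. A t powr (p - 1) * D t / (p + 1)) \<longlongrightarrow> 0) at_top"
  proof (rule tendsto_0_le[where K = 1])
    show "\<forall>\<^sub>F t in at_top. norm (A t powr (p - 1) * D t / (p + 1)) \<le> norm (A t powr p) * 1"
      using eventually_gt_at_top[of 0]
    proof eventually_elim
      case (elim t)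
      note A = A_pos[OF elim]
      have "D t \<le> A t" using A_eq[OF elim] B_nonneg[OF elim] by simp
      also have "\<dots> \<le> A t * (p + 1)" using A p_gt_1 by simp
      finally have "A t powr (p - 1) * D t \<le> A t powr (p - 1) * (A t * (p + 1))"
        by (intro mult_left_mono) auto
      then have "A t powr (p - 1) * D t / (p + 1) \<le> A t powr (p - 1) * A t"
        using p_gt_1 by (simp add: divide_le_eq mult.assoc)
      also have "\<dots> = A t powr p"
        using powr_mult_base[of "A t" "p - 1"] A by (simp add: mult.commute)
      finally show ?case using D_nonneg[OF elim] p_gt_1
        by simp
    qed
  qed
qed

text \<open>Here \<open>t * A\<close> takes the place of \<open>A\<close>: its derivative is
  \<open>D\<close>, that of \<open>t * B\<close> is \<open>2 * E\<close>, and
  \<open>A E \<le> B D\<close> again leaves the factor \<open>p + 1\<close>.\<close>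

lemma lower_Ioo:
  assumes t: "0 < t"
  shows "ennreal ((t * A t) powr (p - 1) * (t * B t) / (p + 1))
    \<le> (\<integral>\<^sup>+y\<in>{0<..<t}. ennreal (y powr p * u y) \<partial>lborel)"
proof (rule nn_integral_Ioo_lower[OF continuous_tu _ _ _ _ t])
  fix t :: real assume t: "0 < t"
  show "((\<lambda>t. (t * A t) powr (p - 1) * (t * B t) / (p + 1)) has_real_derivative
     (((p - 1) * (t * A t) powr (p - 1 - of_nat 1) * D t) * (t * B t) + (2 * E t) * (t * A t) powr (p - 1)) / (p + 1)) (at t)"
    using A_pos[OF t] t by (intro DERIV_cdivide DERIV_mult DERIV_fun_powr deriv_tA deriv_tB) auto
  define X where "X = (t * A t) powr (p - 2) * t * (B t * D t)"
  define Y where "Y = (t * A t) powr (p - 2) * t * (A t * E t)"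
  have "Y \<le> X" unfolding X_def Y_def using AE_le_BD[OF t] t by (intro mult_left_mono) auto
  then have "((p - 1) * X + 2 * Y) / (p + 1) \<le> ((p + 1) * X) / (p + 1)"
    using p_gt_1 by (intro divide_right_mono) (auto simp: algebra_simps)
  moreover have "((p + 1) * X) / (p + 1) = t powr p * u t"
    using p_gt_1 t A_pos[OF t] by (simp add: X_def u_def powr_split' powr_mult)
  moreover have "((p - 1) * (t * A t) powr (p - 1 - of_nat 1) * D t) * (t * B t) + (2 * E t) * (t * A t) powr (p - 1)
      = (p - 1) * X + 2 * Y"
    unfolding X_def Y_def using t A_pos[OF t] by (simp add: powr_split)
  ultimately show "(((p - 1) * (t * A t) powr (p - 1 - of_nat 1) * D t) * (t * B t) + (2 * E t) * (t * A t) powr (p - 1)) / (p + 1)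
      \<le> t powr p * u t"
    by simp
  show "0 \<le> t powr p * u t" using u_nonneg[OF t] by simp
next
  have "((\<lambda>t. (t * A t) powr p) \<longlongrightarrow> 0) (at_right 0)"
  proof (rule tendsto_zero_powrI[OF tA_lim tendsto_const])
    show "\<forall>\<^sub>F t in at_right 0. 0 \<le> t * A t"
      using eventually_at_right_less[of 0] by eventually_elim (simp add: A_pos less_imp_le)
  qed (use p_gt_1 in simp)
  then show "((\<lambda>t. (t * A t) powr (p - 1) * (t * B t) / (p + 1)) \<longlongrightarrow> 0) (at_right 0)"
  proof (rule tendsto_0_le[where K = 1])
    show "\<forall>\<^sub>F t in at_right 0. norm ((t * A t) powr (p - 1) * (t * B t) / (p + 1)) \<le> norm ((t * A t) powr p) * 1"
      using eventually_at_right_less[of 0]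
    proof eventually_elim
      case (elim t)
      have tA: "0 < t * A t" using elim A_pos by simp
      have "B t \<le> A t" using A_eq[OF elim] D_nonneg[OF elim] by simp
      also have "\<dots> \<le> A t * (p + 1)" using A_pos[OF elim] p_gt_1 by simp
      finally have "(t * A t) powr (p - 1) * (t * B t) \<le> (t * A t) powr (p - 1) * (t * (A t * (p + 1)))"
        using elim by (intro mult_left_mono) auto
      then have "(t * A t) powr (p - 1) * (t * B t) / (p + 1) \<le> (t * A t) powr (p - 1) * (t * A t)"
        using p_gt_1 by (simp add: divide_le_eq mult.assoc)
      also have "\<dots> = (t * A t) powr p"
        using powr_mult_base[of "t * A t" "p - 1"] tA by (simp add: mult.commute)
      finally show ?case using B_nonneg[OF elim] elim p_gt_1
        by simp
    qed
  qed
qed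

section \<open>The kernel integral comparable to \<open>A powr p\<close>\<close>

definition J :: "real \<Rightarrow> ennreal" where
  "J t = (\<integral>\<^sup>+y\<in>{0<..}. ennreal (min 1 (y / t) powr p * u y) \<partial>lborel)"

lemma J_split:
  assumes t: "0 < t"
  shows "J t = ennreal (t powr - p) * (\<integral>\<^sup>+y\<in>{0<..<t}. ennreal (y powr p * u y) \<partial>lborel)
                + (\<integral>\<^sup>+y\<in>{t<..}. ennreal (u y) \<partial>lborel)"
proof -
  have [measurable]: "(\<lambda>y. u y * indicator {0<..} y) \<in> borel_measurable borel"
    using borel_measurable_continuous_on_indicator[OF _ continuous_u] by (simp add: mult.commute)
  have "(\<lambda>y. ennreal (y powr p * u y) * indicator {0<..<t} y)
      = (\<lambda>y. ennreal (y powr p * (u y * indicator {0<..} y)) * indicator {0<..<t} y)"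
    by (auto simp: fun_eq_iff indicator_def)
  then have m1: "(\<lambda>y. ennreal (y powr p * u y) * indicator {0<..<t} y) \<in> borel_measurable borel"
    by simp
  have "(\<lambda>y. ennreal (u y) * indicator {t<..} y)
      = (\<lambda>y. ennreal (u y * indicator {0<..} y) * indicator {t<..} y)"
    using t by (auto simp: fun_eq_iff indicator_def)
  then have m2: "(\<lambda>y. ennreal (u y) * indicator {t<..} y) \<in> borel_measurable borel"
    by simp
  have "J t = (\<integral>\<^sup>+y. ennreal (t powr - p) * (ennreal (y powr p * u y) * indicator {0<..<t} y)
                  + ennreal (u y) * indicator {t<..} y \<partial>lborel)"
    unfolding J_def
  proof (rule nn_integral_cong_AE)
    show "AE y in lborel. ennreal (min 1 (y / t) powr p * u y) * indicator {0<..} y =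
      ennreal (t powr - p) * (ennreal (y powr p * u y) * indicator {0<..<t} y)
                  + ennreal (u y) * indicator {t<..} y"
      \<comment> \<open>The two open ranges miss the point \<open>y = t\<close>, discarded as a null
        set.\<close>
      using AE_lborel_singleton[of t]
    proof eventually_elim
      case (elim y)
      have "ennreal (t powr - p) * ennreal (y powr p * u y) = ennreal ((y / t) powr p * u y)" if "0 < y"
        using that t u_nonneg[OF that]
        by (subst ennreal_mult[symmetric]) (auto simp: powr_divide powr_minus field_simps)
      then show ?case using elim t
        by (auto simp: indicator_def min_def divide_simps split: if_splits)
    qed
  qed
  also have "\<dots> = ennreal (t powr - p) * (\<integral>\<^sup>+y\<in>{0<..<t}. ennreal (y powr p * u y) \<partial>lborel)
                + (\<integral>\<^sup>+y\<in>{t<..}. ennreal (u y) \<partial>lborel)"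
    using m1 m2 by (subst nn_integral_add) (auto simp: nn_integral_cmult)
  finally show ?thesis .
qed

text \<open>Each of the two pieces contributes at most \<open>A powr p / p\<close>, the factor
  \<open>t powr - p\<close> cancelling \<open>t powr p\<close> in the first.\<close>

lemma J_upper:
  assumes t: "0 < t" shows "J t \<le> ennreal (2 / p * A t powr p)"
proof -
  have "J t \<le> ennreal (t powr - p) * ennreal ((t * A t) powr p / p) + ennreal (A t powr p / p)"
    unfolding J_split[OF t] by (intro add_mono mult_left_mono upper_Ioo upper_Ioi t) auto
  also have "\<dots> = ennreal (2 / p * A t powr p)"
    using p_gt_1 t A_pos[OF t]
    by (simp add: ennreal_mult[symmetric] ennreal_plus[symmetric] powr_mult powr_minus field_simps del: ennreal_plus)
  finally show ?thesis .
qed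

text \<open>The two lower bounds add up to \<open>A powr (p - 1) * (B + D) / (p + 1)\<close>, and
  \<open>B + D = A\<close>.\<close>

lemma J_lower:
  assumes t: "0 < t" shows "ennreal (A t powr p) \<le> ennreal (p + 1) * J t"
proof -
  have eq: "t powr - p * ((t * A t) powr (p - 1) * (t * B t) / (p + 1)) + A t powr (p - 1) * D t / (p + 1)
     = A t powr p / (p + 1)"
  proof -
    have A: "A t powr p = A t powr (p - 1) * A t"
      using powr_mult_base[of "A t" "p - 1"] A_pos[OF t] by (simp add: mult.commute)
    have "t powr - p * ((t * A t) powr (p - 1) * (t * B t)) = A t powr (p - 1) * B t"
      using t A_pos[OF t] powr_mult_base[of t "p - 1"] by (simp add: powr_mult powr_minus field_simps)
    then have "t powr - p * ((t * A t) powr (p - 1) * (t * B t) / (p + 1)) + A t powr (p - 1) * D t / (p + 1)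
      = A t powr (p - 1) * (B t + D t) / (p + 1)"
      by (simp add: add_divide_distrib distrib_left)
    then show ?thesis using A A_eq[OF t] by simp
  qed
  have "ennreal (A t powr p / (p + 1))
    = ennreal (t powr - p) * ennreal ((t * A t) powr (p - 1) * (t * B t) / (p + 1))
      + ennreal (A t powr (p - 1) * D t / (p + 1))"
    unfolding eq[symmetric] using t p_gt_1 B_nonneg[OF t] D_nonneg[OF t]
    by (subst ennreal_plus) (auto simp: ennreal_mult[symmetric])
  also have "\<dots> \<le> J t"
    unfolding J_split[OF t] by (intro add_mono mult_left_mono lower_Ioo lower_Ioi t) auto
  finally have "ennreal (p + 1) * ennreal (A t powr p / (p + 1)) \<le> ennreal (p + 1) * J t"
    by (rule mult_left_mono) simp
  then show ?thesis using p_gt_1 by (simp add: ennreal_mult[symmetric] del: ennreal_plus)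
qed

end

subsection \<open>Powers and rearrangements\<close>

lemma epow_ennreal: "0 \<le> x \<Longrightarrow> epow (ennreal x) p = ennreal (x powr p)"
  by (simp add: epow_def)

lemma epow_top [simp]: "epow top p = top"
  by (simp add: epow_def)

lemma epow_0 [simp]: "epow 0 p = 0"
  by (simp add: epow_def)

lemma epow_mono: "0 \<le> p \<Longrightarrow> x \<le> y \<Longrightarrow> epow x p \<le> epow y p"
  by (cases x; cases y) (auto simp: epow_ennreal top_unique intro!: ennreal_leI powr_mono2)

lemma epow_mult: "epow (x * y) p = epow x p * epow y p"
proof (cases x; cases y)
  fix a b :: real assume "0 \<le> a" "0 \<le> b" "x = ennreal a" "y = ennreal b"
  then show ?thesis by (simp add: ennreal_mult[symmetric] epow_ennreal powr_mult)
next
  fix a :: real assume "0 \<le> a" "x = ennreal a" "y = top"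
  then show ?thesis by (cases "a = 0") (auto simp: ennreal_mult_top epow_ennreal)
next
  fix a :: real assume "0 \<le> a" "y = ennreal a" "x = top"
  then show ?thesis by (cases "a = 0") (auto simp: ennreal_top_mult epow_ennreal)
qed auto

lemma epow_epow: "epow (epow x p) q = epow x (p * q)"
  by (cases x) (auto simp: epow_ennreal powr_powr)

lemma epow_1 [simp]: "epow x 1 = x"
  by (cases x) (auto simp: epow_ennreal)

lemma epow_le_iff: "0 < p \<Longrightarrow> epow x p \<le> y \<longleftrightarrow> x \<le> epow y (1 / p)"
  using epow_mono[of p x "epow y (1 / p)"] epow_mono[of "1 / p" "epow x p" y]
  by (auto simp: epow_epow)

text \<open>Any \<open>c\<close> below \<open>liminf X\<close> is eventually below
  \<open>X n\<close>; monotonicity then suffices, with the power moved to the other side as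
  \<open>1 / p\<close>.\<close>

lemma epow_liminf_le:
  assumes p: "0 < p" shows "epow (liminf X) p \<le> liminf (\<lambda>n. epow (X n) p)"
proof -
  have "c \<le> epow (liminf (\<lambda>n. epow (X n) p)) (1 / p)" if "c < liminf X" for c
  proof -
    have "\<forall>\<^sub>F n in sequentially. c < X n" using that le_Liminf_iff[of "liminf X"] by auto
    then have "\<forall>\<^sub>F n in sequentially. epow c p \<le> epow (X n) p"
      by eventually_elim (use p in \<open>auto intro: epow_mono\<close>)
    then have "epow c p \<le> liminf (\<lambda>n. epow (X n) p)" by (rule Liminf_bounded)
    then show ?thesis using p by (simp add: epow_le_iff)
  qed
  then show ?thesis unfolding epow_le_iff[OF p] by (rule dense_le)
qed

section \<open>Distribution functions and equimeasurability\<close>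

definition distr_fn :: "(real \<Rightarrow> ennreal) \<Rightarrow> real \<Rightarrow> ennreal" where
  "distr_fn f l = emeasure lebesgue {x\<in>{0<..}. ennreal l < f x}"

lemma rearr_distr_fn: "rearr f t = (INF l\<in>{l. 0 < l \<and> distr_fn f l \<le> ennreal t}. ennreal l)"
  by (simp add: rearr_def distr_fn_def)

lemma M_plus_sets:
  assumes "f \<in> M_plus" shows "{x\<in>{0<..}. ennreal l < f x} \<in> sets lebesgue"
proof -
  have "{x \<in> space (restrict_space lebesgue {0<..}). ennreal l < f x} \<in> sets (restrict_space lebesgue {0<..})"
    using assms unfolding M_plus_def by measurable
  then show ?thesis by (subst (asm) sets_restrict_space_iff) (auto simp: space_restrict_space)
qed

text \<open>The rearrangement is the generalised inverse of the distribution function. The direction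
  not immediate from the infimum rests on right continuity: \<open>{f > l}\<close> is the increasing
  union of the sets \<open>{f > l + 1/(n+1)}\<close>.\<close>

lemma less_rearr_iff:
  assumes f: "f \<in> M_plus" and l: "0 < l"
  shows "ennreal l < rearr f t \<longleftrightarrow> ennreal t < distr_fn f l"
proof -
  have "rearr f t \<le> ennreal l" if "distr_fn f l \<le> ennreal t"
    unfolding rearr_distr_fn using l that by (auto intro: INF_lower)
  moreover have "distr_fn f l \<le> ennreal t" if le: "rearr f t \<le> ennreal l"
  proof -
    define A where "A = (\<lambda>n. {x\<in>{0<..}. ennreal (l + 1 / real (n + 1)) < f x})"
    have un: "{x\<in>{0<..}. ennreal l < f x} = (\<Union>n. A n)"
    proof safe
      fix x :: real assume x: "0 < x" "ennreal l < f x"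
      then obtain q where q: "ennreal l < ennreal q" "ennreal q < f x" "0 \<le> q"
        by (metis dense ennreal_cases order.strict_implies_not_eq top_greatest order_less_le_trans)
      then have "0 < q - l" using l by (simp add: ennreal_less_iff)
      then obtain n where "inverse (real (Suc n)) < q - l" using reals_Archimedean by blast
      then have "ennreal (l + 1 / real (n + 1)) \<le> ennreal q" by (intro ennreal_leI) (simp add: field_simps)
      with q(2) have "ennreal (l + 1 / real (n + 1)) < f x" by (auto intro: le_less_trans)
      then have "x \<in> A n" using x by (simp add: A_def)
      then show "x \<in> (\<Union>n. A n)" by blast
    next
      fix x n assume "x \<in> A n"
      then have x: "0 < x" "ennreal (l + 1 / real (n + 1)) < f x" by (auto simp: A_def)
      have "ennreal l \<le> ennreal (l + 1 / real (n + 1))" by (intro ennreal_leI) simp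
      then show "x > 0" "ennreal l < f x" using x by (auto intro: le_less_trans)
    qed
    have "incseq A"
    proof (intro incseq_SucI)
      fix n
      have "ennreal (l + 1 / real (Suc n + 1)) \<le> ennreal (l + 1 / real (n + 1))"
        by (intro ennreal_leI add_left_mono divide_left_mono) auto
      then show "A n \<le> A (Suc n)" by (auto simp: A_def intro: le_less_trans)
    qed
    moreover have "range A \<subseteq> sets lebesgue" using M_plus_sets[OF f] by (auto simp: A_def)
    ultimately have "distr_fn f l = (SUP n. emeasure lebesgue (A n))"
      unfolding distr_fn_def un by (rule SUP_emeasure_incseq[symmetric, rotated])
    also have "\<dots> \<le> ennreal t"
    proof (rule SUP_least)
      fix n
      have "ennreal l < ennreal (l + 1 / real (n + 1))" using l by (simp add: ennreal_less_iff)
      with le have "rearr f t < ennreal (l + 1 / real (n + 1))" by (rule le_less_trans)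
      \<comment> \<open>As the infimum is below \<open>l + 1/(n+1)\<close>, so is some admissible
        level \<open>k\<close>, and \<open>A n\<close> lies in \<open>{f > k}\<close>.\<close>
      then obtain k where k: "0 < k" "distr_fn f k \<le> ennreal t" "ennreal k < ennreal (l + 1 / real (n + 1))"
        unfolding rearr_distr_fn by (auto simp: INF_less_iff)
      have "emeasure lebesgue (A n) \<le> distr_fn f k"
        unfolding distr_fn_def using M_plus_sets[OF f] k(3) by (intro emeasure_mono) (auto simp: A_def)
      with k(2) show "emeasure lebesgue (A n) \<le> ennreal t" by (rule order_trans[rotated])
    qed
    finally show ?thesis .
  qed
  ultimately show ?thesis by (auto simp: not_le[symmetric])
qed

lemma emeasure_lebesgue_scale:
  fixes S :: "real set"
  assumes "0 < s" shows "emeasure lebesgue {x. x / s \<in> S} = ennreal s * emeasure lebesgue S"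
proof -
  have "{x. x / s \<in> S} = (\<lambda>x. 0 + s *\<^sub>R x) ` S"
    using assms by (force simp: image_iff)
  then show ?thesis
    using emeasure_lebesgue_affine[of s 0 S] assms by simp
qed

lemma distr_fn_scale:
  assumes "0 < s" shows "distr_fn (\<lambda>t. f (t / s)) l = ennreal s * distr_fn f l"
proof -
  have "{x\<in>{0<..}. ennreal l < f (x / s)} = {x. x / s \<in> {x\<in>{0<..}. ennreal l < f x}}"
    using assms by (auto simp: zero_less_divide_iff)
  then show ?thesis
    unfolding distr_fn_def by (simp only: emeasure_lebesgue_scale[OF assms])
qed

text \<open>Used with \<open>M\<close> a value of the distribution function: the set where
  \<open>rearr f\<close> exceeds \<open>l > 0\<close> is such a segment, whence \<open>f\<close> and
  \<open>rearr f\<close> are equimeasurable.\<close>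

lemma emeasure_initial_segment:
  "emeasure lebesgue {x\<in>{0<..}. ennreal x < M} = M"
proof (cases M)
  case (real r)
  then have "{x\<in>{0<..}. ennreal x < M} = {0<..<r}" by (auto simp: ennreal_less_iff)
  then show ?thesis using real by simp
next
  case top
  have "\<not> emeasure lebesgue {0::real<..} \<le> ennreal (real n)" for n
  proof
    assume "emeasure lebesgue {0::real<..} \<le> ennreal (real n)"
    moreover have "emeasure lebesgue {0<..<real n + 1} \<le> emeasure lebesgue {0::real<..}"
      by (intro emeasure_mono) auto
    moreover have "emeasure lebesgue {0<..<real n + 1} = ennreal (real n + 1)" by simp
    ultimately have "ennreal (real n + 1) \<le> ennreal (real n)" by (metis order_trans)
    then show False by (subst (asm) ennreal_le_iff) auto
  qed
  then have "emeasure lebesgue {0::real<..} = top"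
    by (metis ennreal_cases ennreal_le_iff real_arch_simple of_nat_0_le_iff)
  then show ?thesis using top by (simp add: greaterThan_def)
qed

lemma distr_fn_rearr:
  assumes "f \<in> M_plus" "0 < l" shows "distr_fn (rearr f) l = distr_fn f l"
  unfolding distr_fn_def[of "rearr f"] less_rearr_iff[OF assms] by (rule emeasure_initial_segment)

lemma rho_distr_fn_cong:
  assumes "\<And>l. 0 < l \<Longrightarrow> distr_fn f l = distr_fn g l"
  shows "rho p \<phi> f = rho p \<phi> g"
proof -
  have "rearr f = rearr g"
    unfolding fun_eq_iff rearr_distr_fn using assms by (auto intro!: arg_cong[where f = Inf] image_cong)
  then show ?thesis by (simp add: rho_def maximal_rearr_def)
qed

lemma rearr_scale:
  assumes s: "0 < s" and t: "0 < t" shows "rearr (\<lambda>x. f (x / s)) t = rearr f (t / s)"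
proof -
  have "ennreal s * d \<le> ennreal t \<longleftrightarrow> d \<le> ennreal (t / s)" for d
    using s t by (cases d) (auto simp: ennreal_mult[symmetric] field_simps ennreal_mult_top top_unique)
  then show ?thesis unfolding rearr_distr_fn distr_fn_scale[OF s] by simp
qed

text \<open>\<open>f\<close> and \<open>rearr f\<close> have the same distribution function at
  positive levels, so do their dilations, and the norm sees nothing else.\<close>

lemma dilation_fn_eq_rearr:
  assumes s: "0 < s"
  shows "dilation_fn (rho p \<phi>) s =
            (SUP f\<in>admissible (rho p \<phi>).
               rho p \<phi> (\<lambda>t. rearr f (t / s)) / rho p \<phi> (rearr f))"
  unfolding dilation_fn_def
proof (rule SUP_cong[OF refl])
  fix f assume "f \<in> admissible (rho p \<phi>)"
  then have f: "f \<in> M_plus" by (simp add: admissible_def)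
  have "rho p \<phi> (\<lambda>t. f (t / s)) = rho p \<phi> (\<lambda>t. rearr f (t / s))"
    by (rule rho_distr_fn_cong) (simp add: distr_fn_scale[OF s] distr_fn_rearr[OF f])
  moreover have "rho p \<phi> f = rho p \<phi> (rearr f)"
    by (rule rho_distr_fn_cong) (simp add: distr_fn_rearr[OF f])
  ultimately show "rho p \<phi> (\<lambda>t. f (t / s)) / rho p \<phi> f =
    rho p \<phi> (\<lambda>t. rearr f (t / s)) / rho p \<phi> (rearr f)" by simp
qed

subsection \<open>Dilations of finite sums\<close>

text \<open>The \<open>p\<close>-th power of the fundamental function of the norm with weight
  \<open>w\<close>: \<open>min 1 (t / y)\<close> is the mean over \<open>(0, y)\<close> of the
  characteristic function of \<open>(0, t)\<close>.\<close>

definition fundamental :: "real \<Rightarrow> (real \<Rightarrow> real) \<Rightarrow> real \<Rightarrow> ennreal" where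
  "fundamental p w t = (\<integral>\<^sup>+y\<in>{0<..}. ennreal (min 1 (t / y) powr p) * ennreal (w y) \<partial>lborel)"

context step_sum
begin

text \<open>Extension of \<open>u\<close> by zero, Borel on the whole line as Tonelli's theorem
  requires.\<close>

definition v :: "real \<Rightarrow> real" where "v y = u y * indicator {0<..} y"

lemma v_measurable [measurable]: "v \<in> borel_measurable borel"
  unfolding v_def[abs_def]
  using borel_measurable_continuous_on_indicator[OF _ continuous_u] by (simp add: mult.commute)

lemma J_eq: "J t = (\<integral>\<^sup>+y. ennreal (min 1 (y / t) powr p) * ennreal (v y) \<partial>lborel)"
  unfolding J_def by (intro nn_integral_cong) (auto simp: v_def indicator_def ennreal_mult u_nonneg)

text \<open>By Tonelli's theorem the integral over \<open>t\<close> may come first; the kernel there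
  is \<open>min 1 (y / (t / r)) = min 1 (r * y / t)\<close>, which produces the fundamental function
  at \<open>r * y\<close>.\<close>

lemma integral_J:
  assumes [measurable]: "w \<in> borel_measurable borel" and r: "0 < r"
  shows "(\<integral>\<^sup>+t\<in>{0<..}. J (t / r) * ennreal (w t) \<partial>lborel)
       = (\<integral>\<^sup>+y. ennreal (v y) * fundamental p w (r * y) \<partial>lborel)"
proof -
  have "(\<integral>\<^sup>+t\<in>{0<..}. J (t / r) * ennreal (w t) \<partial>lborel)
    = (\<integral>\<^sup>+t. \<integral>\<^sup>+y. ennreal (min 1 (y / (t / r)) powr p) * ennreal (v y) * (ennreal (w t) * indicator {0<..} t) \<partial>lborel \<partial>lborel)"
    unfolding J_eq by (subst nn_integral_multc) (auto simp: mult.assoc)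
  also have "\<dots> = (\<integral>\<^sup>+y. \<integral>\<^sup>+t. ennreal (min 1 (y / (t / r)) powr p) * ennreal (v y) * (ennreal (w t) * indicator {0<..} t) \<partial>lborel \<partial>lborel)"
    by (rule lborel_pair.Fubini') simp
  also have "\<dots> = (\<integral>\<^sup>+y. ennreal (v y) * fundamental p w (r * y) \<partial>lborel)"
    unfolding fundamental_def
    by (subst nn_integral_cmult[symmetric])
      (auto intro!: nn_integral_cong simp: mult_ac)
  finally show ?thesis .
qed

lemma A_measurable [measurable]: "A \<in> borel_measurable borel"
  unfolding A_def[abs_def] by measurable

text \<open>The chain passes from \<open>A (t / s) powr p\<close> to \<open>J (t / s)\<close> at the
  cost of \<open>p + 1\<close>, to \<open>fundamental\<close> at \<open>s * y\<close>, to
  \<open>K\<close> times its value at \<open>y\<close>, back to \<open>J t\<close>, and to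
  \<open>A t powr p\<close> at the cost of \<open>2 / p\<close>. The factor \<open>K\<close> may be
  infinite.\<close>

lemma dilation_A_le:
  assumes w [measurable]: "w \<in> borel_measurable borel" and s: "0 < s"
    and K: "\<And>y. 0 < y \<Longrightarrow> fundamental p w (s * y) \<le> K * fundamental p w y"
  shows "(\<integral>\<^sup>+t\<in>{0<..}. ennreal (A (t / s) powr p) * ennreal (w t) \<partial>lborel)
      \<le> ennreal (2 * (p + 1) / p) * K * (\<integral>\<^sup>+t\<in>{0<..}. ennreal (A t powr p) * ennreal (w t) \<partial>lborel)"
proof -
  let ?N = "\<integral>\<^sup>+t\<in>{0<..}. ennreal (A t powr p) * ennreal (w t) \<partial>lborel"
  have [measurable]: "J \<in> borel_measurable borel"
    unfolding J_eq[abs_def] by measurable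
  have "(\<integral>\<^sup>+t\<in>{0<..}. ennreal (A (t / s) powr p) * ennreal (w t) \<partial>lborel)
      \<le> (\<integral>\<^sup>+t. ennreal (p + 1) * (J (t / s) * ennreal (w t) * indicator {0<..} t) \<partial>lborel)"
  proof (rule nn_integral_mono)
    fix t
    show "ennreal (A (t / s) powr p) * ennreal (w t) * indicator {0<..} t
      \<le> ennreal (p + 1) * (J (t / s) * ennreal (w t) * indicator {0<..} t)"
      using mult_right_mono[OF J_lower[of "t / s"], of "ennreal (w t)"] s
      by (auto simp: indicator_def mult.assoc)
  qed
  also have "\<dots> = ennreal (p + 1) * (\<integral>\<^sup>+t\<in>{0<..}. J (t / s) * ennreal (w t) \<partial>lborel)"
    by (rule nn_integral_cmult) simp
  also have "\<dots> = ennreal (p + 1) * (\<integral>\<^sup>+y. ennreal (v y) * fundamental p w (s * y) \<partial>lborel)"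
    using integral_J[OF w s] by simp
  also have "\<dots> \<le> ennreal (p + 1) * (\<integral>\<^sup>+y. K * (ennreal (v y) * fundamental p w (1 * y)) \<partial>lborel)"
  proof (intro mult_left_mono nn_integral_mono)
    fix y
    show "ennreal (v y) * fundamental p w (s * y) \<le> K * (ennreal (v y) * fundamental p w (1 * y))"
      using mult_left_mono[OF K[of y], of "ennreal (v y)"]
      by (cases "0 < y") (auto simp: v_def mult_ac)
  qed simp
  also have "(\<integral>\<^sup>+y. K * (ennreal (v y) * fundamental p w (1 * y)) \<partial>lborel)
     = K * (\<integral>\<^sup>+y. ennreal (v y) * fundamental p w (1 * y) \<partial>lborel)"
    unfolding fundamental_def by (rule nn_integral_cmult) measurable
  also have "(\<integral>\<^sup>+y. ennreal (v y) * fundamental p w (1 * y) \<partial>lborel)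
     = (\<integral>\<^sup>+t\<in>{0<..}. J t * ennreal (w t) \<partial>lborel)"
    using integral_J[OF w zero_less_one] by simp
  also have "\<dots> \<le> (\<integral>\<^sup>+t. ennreal (2 / p) * (ennreal (A t powr p) * ennreal (w t) * indicator {0<..} t) \<partial>lborel)"
  proof (rule nn_integral_mono)
    fix t
    have "J t \<le> ennreal (2 / p) * ennreal (A t powr p)" if "0 < t"
      using J_upper[OF that] p_gt_1 by (subst ennreal_mult[symmetric]) auto
    then show "J t * ennreal (w t) * indicator {0<..} t
      \<le> ennreal (2 / p) * (ennreal (A t powr p) * ennreal (w t) * indicator {0<..} t)"
      using mult_right_mono[of "J t" "ennreal (2 / p) * ennreal (A t powr p)" "ennreal (w t)"]
      by (auto simp: indicator_def mult.assoc)
  qed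
  also have "\<dots> = ennreal (2 / p) * ?N" by (rule nn_integral_cmult) simp
  finally have "(\<integral>\<^sup>+t\<in>{0<..}. ennreal (A (t / s) powr p) * ennreal (w t) \<partial>lborel)
    \<le> ennreal (p + 1) * (K * (ennreal (2 / p) * ?N))"
    by (simp add: mult_left_mono)
  also have "\<dots> = (ennreal (p + 1) * ennreal (2 / p)) * K * ?N"
    by (simp only: mult_ac)
  also have "ennreal (p + 1) * ennreal (2 / p) = ennreal (2 * (p + 1) / p)"
    using p_gt_1 by (subst ennreal_mult[symmetric]) (auto simp: mult.commute)
  finally show ?thesis .
qed

lemma step_le_2A: "0 < t \<Longrightarrow> (\<Sum>i\<in>I. c i * min 1 (m i / t)) \<le> 2 * A t"
  unfolding A_def sum_distrib_left
proof (rule sum_mono)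
  fix i assume t: "0 < t" and i: "i \<in> I"
  have "min 1 (m i / t) \<le> 2 * (m i / (t + m i))"
    using m_pos[OF i] t by (cases "m i \<le> t") (auto simp: min_def field_simps)
  then have "c i * min 1 (m i / t) \<le> c i * (2 * (m i / (t + m i)))"
    using c_pos[OF i] by (intro mult_left_mono) auto
  then show "c i * min 1 (m i / t) \<le> 2 * (c i * m i / (t + m i))" by (simp add: mult_ac)
qed

lemma A_le_step: "0 < t \<Longrightarrow> A t \<le> (\<Sum>i\<in>I. c i * min 1 (m i / t))"
  unfolding A_def
proof (rule sum_mono)
  fix i assume t: "0 < t" and i: "i \<in> I"
  have "m i / (t + m i) \<le> min 1 (m i / t)"
    using m_pos[OF i] t by (auto simp: field_simps)
  then have "c i * (m i / (t + m i)) \<le> c i * min 1 (m i / t)"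
    using c_pos[OF i] by (intro mult_left_mono) auto
  then show "c i * m i / (t + m i) \<le> c i * min 1 (m i / t)" by simp
qed

text \<open>The factor \<open>2 powr p\<close> comes from bounding the dilated means by
  \<open>2 * A\<close>; on the right \<open>A\<close> is bounded by the means without loss.\<close>

lemma dilation_step_le_of_pos:
  assumes w [measurable]: "w \<in> borel_measurable borel" and s: "0 < s"
    and K: "\<And>y. 0 < y \<Longrightarrow> fundamental p w (s * y) \<le> K * fundamental p w y"
  shows "(\<integral>\<^sup>+t\<in>{0<..}. ennreal ((\<Sum>i\<in>I. c i * min 1 (m i / (t / s))) powr p) * ennreal (w t) \<partial>lborel)
      \<le> ennreal (2 powr p * (2 * (p + 1) / p)) * K *
        (\<integral>\<^sup>+t\<in>{0<..}. ennreal ((\<Sum>i\<in>I. c i * min 1 (m i / t)) powr p) * ennreal (w t) \<partial>lborel)"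
proof -
  have "(\<integral>\<^sup>+t\<in>{0<..}. ennreal ((\<Sum>i\<in>I. c i * min 1 (m i / (t / s))) powr p) * ennreal (w t) \<partial>lborel)
     \<le> (\<integral>\<^sup>+t. ennreal (2 powr p) * (ennreal (A (t / s) powr p) * ennreal (w t) * indicator {0<..} t) \<partial>lborel)"
  proof (rule nn_integral_mono)
    fix t :: real
    have "ennreal ((\<Sum>i\<in>I. c i * min 1 (m i / (t / s))) powr p) \<le> ennreal (2 powr p) * ennreal (A (t / s) powr p)"
      if "0 < t"
    proof -
      have t: "0 < t / s" using that s by simp
      have "(\<Sum>i\<in>I. c i * min 1 (m i / (t / s))) powr p \<le> (2 * A (t / s)) powr p"
        using p_gt_1 order_trans[OF less_imp_le[OF A_pos[OF t]] A_le_step[OF t]]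
        by (intro powr_mono2 step_le_2A t) auto
      also have "\<dots> = 2 powr p * A (t / s) powr p"
        using A_pos[OF t] by (simp add: powr_mult)
      finally show ?thesis by (subst ennreal_mult[symmetric]) (auto intro: ennreal_leI)
    qed
    then show "ennreal ((\<Sum>i\<in>I. c i * min 1 (m i / (t / s))) powr p) * ennreal (w t) * indicator {0<..} t
      \<le> ennreal (2 powr p) * (ennreal (A (t / s) powr p) * ennreal (w t) * indicator {0<..} t)"
      using mult_right_mono[of _ _ "ennreal (w t)"]
      by (auto simp: indicator_def mult.assoc[symmetric] simp del: divide_divide_eq_right)
  qed
  also have "\<dots> = ennreal (2 powr p) * (\<integral>\<^sup>+t\<in>{0<..}. ennreal (A (t / s) powr p) * ennreal (w t) \<partial>lborel)"
    by (rule nn_integral_cmult) simp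
  also have "\<dots> \<le> ennreal (2 powr p) * (ennreal (2 * (p + 1) / p) * K * (\<integral>\<^sup>+t\<in>{0<..}. ennreal (A t powr p) * ennreal (w t) \<partial>lborel))"
    by (intro mult_left_mono dilation_A_le w s K) auto
  also have "\<dots> = ennreal (2 powr p * (2 * (p + 1) / p)) * K * (\<integral>\<^sup>+t\<in>{0<..}. ennreal (A t powr p) * ennreal (w t) \<partial>lborel)"
    using p_gt_1 by (subst ennreal_mult) (auto simp: mult.assoc)
  also have "\<dots> \<le> ennreal (2 powr p * (2 * (p + 1) / p)) * K *
        (\<integral>\<^sup>+t\<in>{0<..}. ennreal ((\<Sum>i\<in>I. c i * min 1 (m i / t)) powr p) * ennreal (w t) \<partial>lborel)"
  proof (intro mult_left_mono nn_integral_mono)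
    fix t
    have "ennreal (A t powr p) \<le> ennreal ((\<Sum>i\<in>I. c i * min 1 (m i / t)) powr p)" if "0 < t"
      using A_pos[OF that] A_le_step[OF that] p_gt_1 by (intro ennreal_leI powr_mono2) auto
    then show "ennreal (A t powr p) * ennreal (w t) * indicator {0<..} t
      \<le> ennreal ((\<Sum>i\<in>I. c i * min 1 (m i / t)) powr p) * ennreal (w t) * indicator {0<..} t"
      by (auto simp: indicator_def intro: mult_right_mono)
  qed simp
  finally show ?thesis .
qed

end

text \<open>Terms with \<open>c i = 0\<close> or \<open>m i = 0\<close> vanish and are dropped to
  reach the positive case; if none remain, both integrals are 0.\<close>

lemma dilation_step_le:
  fixes c m :: "'i \<Rightarrow> real"
  assumes p: "1 < p" and fin: "finite I" and nn: "\<And>i. i \<in> I \<Longrightarrow> 0 \<le> c i" "\<And>i. i \<in> I \<Longrightarrow> 0 \<le> m i"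
    and w: "w \<in> borel_measurable borel" and s: "0 < s"
    and K: "\<And>y. 0 < y \<Longrightarrow> fundamental p w (s * y) \<le> K * fundamental p w y"
  shows "(\<integral>\<^sup>+t\<in>{0<..}. ennreal ((\<Sum>i\<in>I. c i * min 1 (m i / (t / s))) powr p) * ennreal (w t) \<partial>lborel)
      \<le> ennreal (2 powr p * (2 * (p + 1) / p)) * K *
        (\<integral>\<^sup>+t\<in>{0<..}. ennreal ((\<Sum>i\<in>I. c i * min 1 (m i / t)) powr p) * ennreal (w t) \<partial>lborel)"
proof -
  define I' where "I' = {i\<in>I. 0 < c i \<and> 0 < m i}"
  have eq: "(\<Sum>i\<in>I. c i * min 1 (m i / t)) = (\<Sum>i\<in>I'. c i * min 1 (m i / t))" for t
  proof (rule sum.mono_neutral_right[OF fin])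
    show "\<forall>i\<in>I - I'. c i * min 1 (m i / t) = 0"
    proof
      fix i assume "i \<in> I - I'"
      then have "c i = 0 \<or> m i = 0" using nn[of i] by (auto simp: I'_def)
      then show "c i * min 1 (m i / t) = 0" by auto
    qed
  qed (auto simp: I'_def)
  show ?thesis
  proof (cases "I' = {}")
    case True
    then show ?thesis unfolding eq by simp
  next
    case False
    interpret step_sum I' c m p
      by unfold_locales (use False p fin in \<open>auto simp: I'_def\<close>)
    show ?thesis unfolding eq by (rule dilation_step_le_of_pos[OF w s K])
  qed
qed

text \<open>Restricted to \<open>(0, t)\<close>, a dilated indicator is that of
  \<open>(0, min t (s * m i))\<close>, whose length is
  \<open>t * min 1 (m i / (t / s))\<close>.\<close>

lemma integral_step:
  fixes c m :: "'i \<Rightarrow> real"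
  assumes nn: "\<And>i. i \<in> I \<Longrightarrow> 0 \<le> c i" "\<And>i. i \<in> I \<Longrightarrow> 0 \<le> m i" and s: "0 < s" and t: "0 < t"
  shows "(\<integral>\<^sup>+x\<in>{0<..<t}. ennreal (\<Sum>i\<in>I. c i * indicator {0<..<m i} (x / s)) \<partial>lborel)
    = ennreal t * ennreal (\<Sum>i\<in>I. c i * min 1 (m i / (t / s)))"
proof -
  have "(\<integral>\<^sup>+x\<in>{0<..<t}. ennreal (\<Sum>i\<in>I. c i * indicator {0<..<m i} (x / s)) \<partial>lborel)
    = (\<integral>\<^sup>+x. (\<Sum>i\<in>I. ennreal (c i) * indicator {0<..<min t (s * m i)} x) \<partial>lborel)"
  proof (rule nn_integral_cong)
    fix x
    have "ennreal (c i * indicator {0<..<m i} (x / s)) * indicator {0<..<t} x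
       = ennreal (c i) * indicator {0<..<min t (s * m i)} x" for i
      using s t by (auto simp: indicator_def zero_less_divide_iff field_simps)
    moreover have "ennreal (\<Sum>i\<in>I. c i * indicator {0<..<m i} (x / s))
       = (\<Sum>i\<in>I. ennreal (c i * indicator {0<..<m i} (x / s)))"
      using nn by (intro sum_ennreal[symmetric]) simp
    ultimately show "ennreal (\<Sum>i\<in>I. c i * indicator {0<..<m i} (x / s)) * indicator {0<..<t} x
       = (\<Sum>i\<in>I. ennreal (c i) * indicator {0<..<min t (s * m i)} x)"
      by (simp only: sum_distrib_right)
  qed
  also have "\<dots> = (\<Sum>i\<in>I. ennreal (c i) * ennreal (min t (s * m i)))"
    using s t nn by (subst nn_integral_sum) (auto simp: nn_integral_cmult intro!: sum.cong)
  also have "\<dots> = (\<Sum>i\<in>I. ennreal t * ennreal (c i * min 1 (m i / (t / s))))"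
  proof (rule sum.cong[OF refl])
    fix i assume i: "i \<in> I"
    have "min t (s * m i) = t * min 1 (m i / (t / s))"
      using t by (auto simp: min_def field_simps)
    then have "c i * min t (s * m i) = t * (c i * min 1 (m i / (t / s)))"
      by simp
    then show "ennreal (c i) * ennreal (min t (s * m i)) = ennreal t * ennreal (c i * min 1 (m i / (t / s)))"
      using nn[OF i] s t by (subst (1 2) ennreal_mult[symmetric]) auto
  qed
  also have "\<dots> = ennreal t * ennreal (\<Sum>i\<in>I. c i * min 1 (m i / (t / s)))"
    unfolding sum_distrib_left[symmetric] using nn s t by (subst sum_ennreal) simp_all
  finally show ?thesis .
qed

subsection \<open>Approximation of the rearrangement from below\<close>

text \<open>For \<open>k > 0\<close> and measurable \<open>f\<close> this is the right end of the
  set where the rearrangement exceeds \<open>k/(n+1)\<close>, truncated at \<open>n + 1\<close> to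
  stay finite.\<close>

definition cut_level :: "(real \<Rightarrow> ennreal) \<Rightarrow> nat \<Rightarrow> nat \<Rightarrow> real" where
  "cut_level f n k = enn2real (min (distr_fn f (real k / real (n + 1))) (ennreal (real (n + 1))))"

text \<open>A discrete layer-cake sum with layers of thickness \<open>1/(n+1)\<close>; their number
  \<open>(n+1)^2\<close> lets the heights reach \<open>n + 1\<close>.\<close>

definition rearr_step :: "(real \<Rightarrow> ennreal) \<Rightarrow> nat \<Rightarrow> real \<Rightarrow> real" where
  "rearr_step f n x = (\<Sum>k\<in>{1..(n + 1)\<^sup>2}. 1 / real (n + 1) * indicator {0<..<cut_level f n k} x)"

text \<open>The mean of \<open>rearr_step f n\<close> over \<open>(0, t)\<close> in closed
  form.\<close>

definition mean_step :: "(real \<Rightarrow> ennreal) \<Rightarrow> nat \<Rightarrow> real \<Rightarrow> real" where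
  "mean_step f n t = (\<Sum>k\<in>{1..(n + 1)\<^sup>2}. 1 / real (n + 1) * min 1 (cut_level f n k / t))"

lemma cut_level_nonneg [simp]: "0 \<le> cut_level f n k"
  by (simp add: cut_level_def)

lemma less_cut_level_iff:
  assumes f: "f \<in> M_plus" and k: "0 < k" and x: "0 < x"
  shows "x < cut_level f n k \<longleftrightarrow> ennreal (real k / real (n + 1)) < rearr f x \<and> x < real (n + 1)"
proof -
  have "min (distr_fn f (real k / real (n + 1))) (ennreal (real (n + 1))) < top"
    by (simp add: min_less_iff_disj)
  then have "ennreal (cut_level f n k) = min (distr_fn f (real k / real (n + 1))) (ennreal (real (n + 1)))"
    unfolding cut_level_def by (rule ennreal_enn2real)
  moreover have "x < cut_level f n k \<longleftrightarrow> ennreal x < ennreal (cut_level f n k)"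
    using x by (simp add: ennreal_less_iff)
  ultimately have "x < cut_level f n k \<longleftrightarrow>
      ennreal x < distr_fn f (real k / real (n + 1)) \<and> x < real (n + 1)"
    using x ennreal_less_iff[of x "real (n + 1)"] by (simp only: min_less_iff_conj less_imp_le)
  then show ?thesis using less_rearr_iff[OF f, of "real k / real (n + 1)" x] k by simp
qed

lemma rearr_step_eq_card:
  assumes f: "f \<in> M_plus" and x: "0 < x"
  shows "rearr_step f n x = real (card {k\<in>{1..(n + 1)\<^sup>2}.
    ennreal (real k / real (n + 1)) < rearr f x \<and> x < real (n + 1)}) / real (n + 1)"
proof -
  have "rearr_step f n x = (\<Sum>k\<in>{1..(n + 1)\<^sup>2}.
    if ennreal (real k / real (n + 1)) < rearr f x \<and> x < real (n + 1) then 1 / real (n + 1) else 0)"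
    unfolding rearr_step_def
  proof (rule sum.cong[OF refl])
    fix k assume "k \<in> {1..(n + 1)\<^sup>2}"
    then show "1 / real (n + 1) * indicator {0<..<cut_level f n k} x =
       (if ennreal (real k / real (n + 1)) < rearr f x \<and> x < real (n + 1) then 1 / real (n + 1) else 0)"
      using less_cut_level_iff[OF f _ x, of k n] x by (simp add: indicator_def)
  qed
  also have "\<dots> = real (card {k\<in>{1..(n + 1)\<^sup>2}.
    ennreal (real k / real (n + 1)) < rearr f x \<and> x < real (n + 1)}) / real (n + 1)"
    by (subst sum.inter_filter[symmetric]) auto
  finally show ?thesis .
qed

text \<open>At most \<open>r * (n+1)\<close> of the levels \<open>k/(n+1)\<close> lie below a finite
  value \<open>r\<close>, and each carries the weight \<open>1/(n+1)\<close>.\<close>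

lemma rearr_step_le:
  assumes f: "f \<in> M_plus" and x: "0 < x"
  shows "ennreal (rearr_step f n x) \<le> rearr f x"
proof (cases "rearr f x")
  case (real r)
  have "card {k\<in>{1..(n + 1)\<^sup>2}. ennreal (real k / real (n + 1)) < rearr f x \<and> x < real (n + 1)}
      \<le> card {1..nat \<lfloor>r * real (n + 1)\<rfloor>}"
  proof (rule card_mono)
    show "{k\<in>{1..(n + 1)\<^sup>2}. ennreal (real k / real (n + 1)) < rearr f x \<and> x < real (n + 1)}
      \<subseteq> {1..nat \<lfloor>r * real (n + 1)\<rfloor>}"
    proof
      fix k assume "k \<in> {k\<in>{1..(n + 1)\<^sup>2}. ennreal (real k / real (n + 1)) < rearr f x \<and> x < real (n + 1)}"
      then have k: "1 \<le> k" "real k / real (n + 1) < r"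
        using real by (auto simp: ennreal_less_iff simp del: of_nat_add)
      then have "real k \<le> r * real (n + 1)" by (simp add: field_simps)
      then show "k \<in> {1..nat \<lfloor>r * real (n + 1)\<rfloor>}" using k by (simp add: le_nat_floor)
    qed
  qed simp
  then have "rearr_step f n x \<le> real (nat \<lfloor>r * real (n + 1)\<rfloor>) / real (n + 1)"
    unfolding rearr_step_eq_card[OF f x] by (intro divide_right_mono) auto
  also have "\<dots> \<le> r * real (n + 1) / real (n + 1)"
    using real by (intro divide_right_mono of_nat_floor) auto
  also have "\<dots> = r" by simp
  finally show ?thesis using real by (simp add: ennreal_leI)
qed simp

text \<open>For finite \<open>r\<close> below \<open>rearr f x\<close> and large \<open>n\<close>,
  more than \<open>r * (n+1) - 1\<close> levels are counted, so the step value exceeds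
  \<open>r - 1/(n+1)\<close>. The level grids for successive \<open>n\<close> are not nested, hence
  a lower limit instead of a supremum.\<close>

lemma rearr_le_liminf_step:
  assumes f: "f \<in> M_plus" and x: "0 < x"
  shows "rearr f x \<le> liminf (\<lambda>n. ennreal (rearr_step f n x))"
  unfolding le_Liminf_iff
proof (intro allI impI)
  fix y assume "y < rearr f x"
  \<comment> \<open>The intermediate \<open>z\<close> is finite even if \<open>rearr f x\<close> is
    not.\<close>
  then obtain z where z: "y < z" "z < rearr f x" using dense by blast
  then obtain r where r: "z = ennreal r" "0 \<le> r" by (cases z) auto
  with z obtain a where a: "y = ennreal a" "0 \<le> a" by (cases y) auto
  have ar: "a < r" using z(1) a r by (simp add: ennreal_less_iff)
  \<comment> \<open>\<open>N1\<close> makes the mesh smaller than \<open>r - a\<close>;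
    \<open>N2\<close> puts \<open>x\<close> and \<open>r\<close> below \<open>n + 1\<close>.\<close>
  obtain N1 where N1: "inverse (real (Suc N1)) < r - a" using reals_Archimedean ar by (metis diff_gt_0_iff_gt)
  obtain N2 where N2: "max x r < real N2" using reals_Archimedean2 by blast
  show "\<forall>\<^sub>F n in sequentially. y < ennreal (rearr_step f n x)"
    using eventually_ge_at_top[of "max N1 N2"]
  proof eventually_elim
    case (elim n)
    define q where "q = real (n + 1)"
    have q: "0 < q" "x < q" "r \<le> q" using N2 elim by (auto simp: q_def)
    have "inverse q \<le> inverse (real (Suc N1))" using elim by (intro le_imp_inverse_le) (auto simp: q_def)
    then have iq: "1 / q < r - a" using N1 by (simp add: inverse_eq_divide)
    have "card {1..nat \<lfloor>r * q\<rfloor>}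
      \<le> card {k\<in>{1..(n + 1)\<^sup>2}. ennreal (real k / q) < rearr f x \<and> x < q}"
    proof (rule card_mono)
      show "{1..nat \<lfloor>r * q\<rfloor>} \<subseteq> {k\<in>{1..(n + 1)\<^sup>2}. ennreal (real k / q) < rearr f x \<and> x < q}"
      proof
        fix k assume "k \<in> {1..nat \<lfloor>r * q\<rfloor>}"
        then have k: "1 \<le> k" "k \<le> nat \<lfloor>r * q\<rfloor>" by auto
        have "real (nat \<lfloor>r * q\<rfloor>) \<le> r * q" using r q by (intro of_nat_floor) auto
        with k(2) have kr: "real k \<le> r * q" by linarith
        \<comment> \<open>Here the number of layers matters: \<open>r \<le> q\<close> keeps the
          index within \<open>(n+1)^2\<close>.\<close>
        also have "\<dots> \<le> q * q" using q by (intro mult_right_mono) auto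
        also have "\<dots> = real ((n + 1)\<^sup>2)" by (simp add: q_def power2_eq_square algebra_simps)
        finally have "k \<le> (n + 1)\<^sup>2" by (simp only: of_nat_le_iff)
        moreover have "real k / q \<le> r" using kr q by (simp add: field_simps)
        then have "ennreal (real k / q) < rearr f x" using z r by (auto intro: le_less_trans ennreal_leI)
        ultimately show "k \<in> {k\<in>{1..(n + 1)\<^sup>2}. ennreal (real k / q) < rearr f x \<and> x < q}"
          using k q by simp
      qed
    qed simp
    then have "real (nat \<lfloor>r * q\<rfloor>) / q \<le> rearr_step f n x"
      unfolding rearr_step_eq_card[OF f x] q_def by (intro divide_right_mono) auto
    moreover have "r * q - 1 < real (nat \<lfloor>r * q\<rfloor>)" using r q by linarith
    then have "(r * q - 1) / q < real (nat \<lfloor>r * q\<rfloor>) / q" using q by (intro divide_strict_right_mono)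
    moreover have "(r * q - 1) / q = r - 1 / q" using q by (simp add: field_simps)
    ultimately have "a < rearr_step f n x" using iq by linarith
    then show ?case using a by (simp add: ennreal_less_iff)
  qed
qed

lemma integral_rearr_step:
  assumes "0 < s" "0 < t"
  shows "(\<integral>\<^sup>+x\<in>{0<..<t}. ennreal (rearr_step f n (x / s)) \<partial>lborel) = ennreal t * ennreal (mean_step f n (t / s))"
  unfolding rearr_step_def mean_step_def using assms by (intro integral_step) auto

lemma maximal_rearr_lborel:
  "maximal_rearr f t = (\<integral>\<^sup>+s\<in>{0<..<t}. rearr f s \<partial>lborel) / ennreal t"
  by (simp add: maximal_rearr_def nn_integral_completion)

lemma mean_step_le:
  assumes f: "f \<in> M_plus" and t: "0 < t"
  shows "ennreal (mean_step f n t) \<le> maximal_rearr f t"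
proof -
  have "ennreal t * ennreal (mean_step f n t) = (\<integral>\<^sup>+x\<in>{0<..<t}. ennreal (rearr_step f n x) \<partial>lborel)"
    using integral_rearr_step[of 1 t f n] t by simp
  also have "\<dots> \<le> (\<integral>\<^sup>+x\<in>{0<..<t}. rearr f x \<partial>lborel)"
    using rearr_step_le[OF f] by (intro nn_integral_mono) (auto simp: indicator_def)
  finally have "ennreal (mean_step f n t) * ennreal t / ennreal t \<le> maximal_rearr f t"
    unfolding maximal_rearr_lborel by (intro divide_right_mono_ennreal) (simp add: mult.commute)
  then show ?thesis using t by (simp add: ennreal_mult_divide_eq)
qed

lemma ennreal_liminf_cmult:
  fixes c :: ennreal
  assumes "c < top" shows "liminf (\<lambda>n. c * X n) = c * liminf X"
proof -
  show ?thesis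
    by (rule Liminf_compose_continuous_mono[where f = "\<lambda>x. c * x"])
      (auto intro!: ennreal_continuous_on_cmult[OF assms] monoI mult_left_mono)
qed

text \<open>Fatou's lemma in \<open>x\<close>, applied to the pointwise approximation at
  \<open>x / s\<close>.\<close>

lemma maximal_rearr_scale_le_liminf:
  assumes f: "f \<in> M_plus" and s: "0 < s" and t: "0 < t"
  shows "maximal_rearr (\<lambda>x. f (x / s)) t \<le> liminf (\<lambda>n. ennreal (mean_step f n (t / s)))"
proof -
  have [measurable]: "rearr_step f n \<in> borel_measurable borel" for n
    unfolding rearr_step_def[abs_def] by measurable
  have "(\<integral>\<^sup>+x\<in>{0<..<t}. rearr (\<lambda>x. f (x / s)) x \<partial>lborel)
      \<le> (\<integral>\<^sup>+x. liminf (\<lambda>n. ennreal (rearr_step f n (x / s)) * indicator {0<..<t} x) \<partial>lborel)"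
    using rearr_le_liminf_step[OF f] rearr_scale[OF s] s
    by (intro nn_integral_mono) (auto simp: indicator_def)
  also have "\<dots> \<le> liminf (\<lambda>n. \<integral>\<^sup>+x\<in>{0<..<t}. ennreal (rearr_step f n (x / s)) \<partial>lborel)"
    by (rule nn_integral_liminf) measurable
  also have "\<dots> = liminf (\<lambda>n. ennreal (mean_step f n (t / s))) * ennreal t"
    unfolding integral_rearr_step[OF s t] by (subst ennreal_liminf_cmult) (auto simp: mult.commute)
  finally have "maximal_rearr (\<lambda>x. f (x / s)) t
      \<le> liminf (\<lambda>n. ennreal (mean_step f n (t / s))) * ennreal t / ennreal t"
    unfolding maximal_rearr_lborel by (rule divide_right_mono_ennreal)
  then show ?thesis using t by (simp add: ennreal_mult_divide_eq)
qed

text \<open>Fatou's lemma, now in \<open>t\<close>, reduces the left side to the finite sums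
  \<open>mean_step\<close>. The constant for these does not depend on the number of terms, and
  \<open>mean_step_le\<close> returns to the maximal function on the right.\<close>

lemma dilation_norm_le:
  assumes f: "f \<in> M_plus" and p: "1 < p" and s: "0 < s" and w [measurable]: "w \<in> borel_measurable borel"
    and K: "\<And>y. 0 < y \<Longrightarrow> fundamental p w (s * y) \<le> K * fundamental p w y"
  shows "(\<integral>\<^sup>+t\<in>{0<..}. epow (maximal_rearr (\<lambda>x. f (x / s)) t) p * ennreal (w t) \<partial>lborel)
      \<le> ennreal (2 powr p * (2 * (p + 1) / p)) * K *
        (\<integral>\<^sup>+t\<in>{0<..}. epow (maximal_rearr f t) p * ennreal (w t) \<partial>lborel)"
    (is "?L \<le> ?R")
proof -
  have ms: "0 \<le> mean_step f n t" if "0 < t" for n t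
    unfolding mean_step_def using that by (intro sum_nonneg) auto
  have [measurable]: "mean_step f n \<in> borel_measurable borel" for n
    unfolding mean_step_def[abs_def] by measurable
  have "?L \<le> (\<integral>\<^sup>+t. liminf (\<lambda>n. ennreal (mean_step f n (t / s) powr p) * ennreal (w t) * indicator {0<..} t) \<partial>lborel)"
  proof (rule nn_integral_mono)
    fix t
    show "epow (maximal_rearr (\<lambda>x. f (x / s)) t) p * ennreal (w t) * indicator {0<..} t
      \<le> liminf (\<lambda>n. ennreal (mean_step f n (t / s) powr p) * ennreal (w t) * indicator {0<..} t)"
    proof (cases "0 < t")
      case True
      have "epow (maximal_rearr (\<lambda>x. f (x / s)) t) p \<le> epow (liminf (\<lambda>n. ennreal (mean_step f n (t / s)))) p"
        using p maximal_rearr_scale_le_liminf[OF f s True] by (intro epow_mono) auto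
      also have "\<dots> \<le> liminf (\<lambda>n. epow (ennreal (mean_step f n (t / s))) p)"
        using p by (intro epow_liminf_le) simp
      also have "\<dots> = liminf (\<lambda>n. ennreal (mean_step f n (t / s) powr p))"
        using ms True s by (simp add: epow_ennreal)
      finally have "ennreal (w t) * epow (maximal_rearr (\<lambda>x. f (x / s)) t) p
        \<le> ennreal (w t) * liminf (\<lambda>n. ennreal (mean_step f n (t / s) powr p))"
        by (rule mult_left_mono) simp
      also have "\<dots> = liminf (\<lambda>n. ennreal (w t) * ennreal (mean_step f n (t / s) powr p))"
        by (rule ennreal_liminf_cmult[symmetric]) simp
      finally show ?thesis using True by (simp add: mult.commute)
    qed simp
  qed
  also have "\<dots> \<le> liminf (\<lambda>n. \<integral>\<^sup>+t\<in>{0<..}. ennreal (mean_step f n (t / s) powr p) * ennreal (w t) \<partial>lborel)"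
    by (rule nn_integral_liminf) measurable
  also have "\<dots> \<le> liminf (\<lambda>n::nat. ?R)"
  proof (intro Liminf_mono always_eventually allI)
    fix n
    have "(\<integral>\<^sup>+t\<in>{0<..}. ennreal (mean_step f n (t / s) powr p) * ennreal (w t) \<partial>lborel)
      \<le> ennreal (2 powr p * (2 * (p + 1) / p)) * K *
        (\<integral>\<^sup>+t\<in>{0<..}. ennreal (mean_step f n t powr p) * ennreal (w t) \<partial>lborel)"
      unfolding mean_step_def by (rule dilation_step_le[OF p _ _ _ w s K]) auto
    also have "\<dots> \<le> ?R"
    proof (intro mult_left_mono nn_integral_mono)
      fix t
      have "ennreal (mean_step f n t powr p) \<le> epow (maximal_rearr f t) p" if "0 < t"
        using epow_mono[OF _ mean_step_le[OF f that], of p n] ms[OF that] p by (simp add: epow_ennreal)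
      then show "ennreal (mean_step f n t powr p) * ennreal (w t) * indicator {0<..} t
        \<le> epow (maximal_rearr f t) p * ennreal (w t) * indicator {0<..} t"
        by (auto simp: indicator_def intro: mult_right_mono)
    qed simp
    finally show "(\<integral>\<^sup>+t\<in>{0<..}. ennreal (mean_step f n (t / s) powr p) * ennreal (w t) \<partial>lborel) \<le> ?R" .
  qed
  also have "\<dots> = ?R" by (rule Liminf_const) simp
  finally show ?thesis .
qed

subsection \<open>Borel versions of the weight and characteristic functions\<close>

text \<open>Integrability on each \<open>(0, n+1)\<close> makes the weight, cut off to the
  half-line, a limit of Lebesgue measurable functions. A Borel representative is wanted for
  Tonelli's theorem.\<close>

lemma weight_borel_version:
  assumes "weight \<phi>"
  obtains w where "w \<in> borel_measurable borel" "AE y in lborel. 0 < y \<longrightarrow> \<phi> y = w y"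
proof -
  have "(\<lambda>y. indicator {0<..} y * \<phi> y) \<in> borel_measurable lebesgue"
  proof (rule borel_measurable_LIMSEQ_real)
    show "(\<lambda>y. indicator {0<..<real (Suc n)} y * \<phi> y) \<in> borel_measurable lebesgue" for n
      using assms borel_measurable_integrable[of lebesgue "\<lambda>y. indicator {0<..<real (Suc n)} y *\<^sub>R \<phi> y"]
      unfolding weight_def set_integrable_def by simp
    fix y :: real
    obtain N where N: "y < real N" using reals_Archimedean2 by blast
    have "\<forall>\<^sub>F n in sequentially. indicator {0<..<real (Suc n)} y * \<phi> y = indicator {0<..} y * \<phi> y"
      using eventually_ge_at_top[of N] by eventually_elim (use N in \<open>auto simp: indicator_def\<close>)
    then show "(\<lambda>n. indicator {0<..<real (Suc n)} y * \<phi> y) \<longlonglongrightarrow> indicator {0<..} y * \<phi> y"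
      by (rule tendsto_eventually)
  qed
  then obtain w where w: "w \<in> borel_measurable lborel" "AE y in lborel. indicator {0<..} y * \<phi> y = w y"
    using completion_ex_borel_measurable_real by blast
  from w(2) have "AE y in lborel. 0 < y \<longrightarrow> \<phi> y = w y"
    by eventually_elim (auto simp: indicator_def)
  with w(1) show ?thesis by (intro that[of w]) simp_all
qed

lemma rho_borel_version:
  assumes "AE y in lborel. 0 < y \<longrightarrow> \<phi> y = w y"
  shows "rho p \<phi> f = epow (\<integral>\<^sup>+t\<in>{0<..}. epow (maximal_rearr f t) p * ennreal (w t) \<partial>lborel) (1 / p)"
proof -
  have "(\<integral>\<^sup>+t\<in>{0<..}. epow (maximal_rearr f t) p * ennreal (\<phi> t) \<partial>lborel)
    = (\<integral>\<^sup>+t\<in>{0<..}. epow (maximal_rearr f t) p * ennreal (w t) \<partial>lborel)"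
  proof (rule nn_integral_cong_AE)
    show "AE t in lborel. epow (maximal_rearr f t) p * ennreal (\<phi> t) * indicator {0<..} t
      = epow (maximal_rearr f t) p * ennreal (w t) * indicator {0<..} t"
      using assms by eventually_elim (auto simp: indicator_def)
  qed
  then show ?thesis by (simp add: rho_def nn_integral_completion)
qed

lemma fundamental_eq:
  assumes w [measurable]: "w \<in> borel_measurable borel"
    and eq: "AE y in lborel. 0 < y \<longrightarrow> \<phi> y = w y" and t: "0 < t"
  shows "fundamental p w t = (\<integral>\<^sup>+y\<in>{0<..<t}. ennreal (\<phi> y) \<partial>lebesgue) +
        ennreal (t powr p) * (\<integral>\<^sup>+y\<in>{t<..}. ennreal (\<phi> y * y powr (- p)) \<partial>lebesgue)"
proof -
  have "fundamental p w t = (\<integral>\<^sup>+y. ennreal (w y) * indicator {0<..<t} y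
      + ennreal (t powr p) * (ennreal (w y * y powr (- p)) * indicator {t<..} y) \<partial>lborel)"
    unfolding fundamental_def
  proof (rule nn_integral_cong_AE)
    show "AE y in lborel. ennreal (min 1 (t / y) powr p) * ennreal (w y) * indicator {0<..} y
      = ennreal (w y) * indicator {0<..<t} y
      + ennreal (t powr p) * (ennreal (w y * y powr (- p)) * indicator {t<..} y)"
      using AE_lborel_singleton[of t]
    proof eventually_elim
      case (elim y)
      have "ennreal ((t / y) powr p) * ennreal (w y) = ennreal (t powr p) * ennreal (w y * y powr (- p))"
        if "0 < y"
      proof -
        have "(t / y) powr p * w y = t powr p * (w y * y powr (- p))"
          using that t by (simp add: powr_divide powr_minus field_simps)
        then show ?thesis by (simp only: ennreal_mult'[symmetric, OF powr_ge_zero])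
      qed
      then show ?case using elim t by (auto simp: indicator_def min_def field_simps)
    qed
  qed
  also have "\<dots> = (\<integral>\<^sup>+y\<in>{0<..<t}. ennreal (w y) \<partial>lborel) +
        ennreal (t powr p) * (\<integral>\<^sup>+y\<in>{t<..}. ennreal (w y * y powr (- p)) \<partial>lborel)"
    by (subst nn_integral_add) (auto simp: nn_integral_cmult)
  also have "(\<integral>\<^sup>+y\<in>{0<..<t}. ennreal (w y) \<partial>lborel) = (\<integral>\<^sup>+y\<in>{0<..<t}. ennreal (\<phi> y) \<partial>lborel)"
  proof (rule nn_integral_cong_AE)
    show "AE y in lborel. ennreal (w y) * indicator {0<..<t} y = ennreal (\<phi> y) * indicator {0<..<t} y"
      using eq by eventually_elim (auto simp: indicator_def)
  qed
  also have "(\<integral>\<^sup>+y\<in>{t<..}. ennreal (w y * y powr (- p)) \<partial>lborel)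
      = (\<integral>\<^sup>+y\<in>{t<..}. ennreal (\<phi> y * y powr (- p)) \<partial>lborel)"
  proof (rule nn_integral_cong_AE)
    show "AE y in lborel. ennreal (w y * y powr (- p)) * indicator {t<..} y
        = ennreal (\<phi> y * y powr (- p)) * indicator {t<..} y"
      using eq by eventually_elim (use t in \<open>auto simp: indicator_def\<close>)
  qed
  finally show ?thesis by (simp add: nn_integral_completion)
qed

lemma weight_quotient_fundamental:
  assumes "w \<in> borel_measurable borel" "AE y in lborel. 0 < y \<longrightarrow> \<phi> y = w y" "0 < s" "0 < t"
  shows "weight_quotient p \<phi> s t = fundamental p w (s * t) / fundamental p w t"
  unfolding weight_quotient_def
  using assms by (simp add: fundamental_eq[OF assms(1,2)] powr_mult)

lemma not_AE_notin_Ioo: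
  fixes t :: real
  assumes "0 < t" shows "\<not> (AE y in lebesgue. y \<notin> {0<..<t})"
proof
  assume "AE y in lebesgue. y \<notin> {0<..<t}"
  then have "emeasure lebesgue {y\<in>space lebesgue. y \<in> {0<..<t}} = 0" by (rule emeasure_eq_0_AE)
  moreover have "{y\<in>space lebesgue. y \<in> {0<..<t}} = {0<..<t}" by auto
  ultimately show False using assms by simp
qed

text \<open>These bounds make division by \<open>fundamental\<close> harmless and give
  characteristic functions a finite norm. A positive function has a positive integral over
  \<open>(0, t)\<close>; finiteness of the tail uses the condition at infinity.\<close>

lemma fundamental_pos_finite:
  assumes \<phi>: "nontrivial_weight p \<phi>" and p: "0 < p" and w: "w \<in> borel_measurable borel"
    and eq: "AE y in lborel. 0 < y \<longrightarrow> \<phi> y = w y" and t: "0 < t"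
  shows "0 < fundamental p w t" "fundamental p w t < top"
proof -
  have pos: "0 < \<phi> y" if "0 < y" for y
    using \<phi> that by (auto simp: nontrivial_weight_def weight_def)
  have meas: "(\<lambda>y. indicator {0<..<a} y *\<^sub>R \<phi> y) \<in> borel_measurable lebesgue" if "0 < a" for a
    using \<phi> that unfolding nontrivial_weight_def weight_def set_integrable_def
    by (auto intro: borel_measurable_integrable)
  have ind: "(\<lambda>y. ennreal (\<phi> y) * indicator {0<..<a} y) = (\<lambda>y. ennreal (indicator {0<..<a} y *\<^sub>R \<phi> y))" for a
    by (auto simp: fun_eq_iff indicator_def)
  have fin: "(\<integral>\<^sup>+y\<in>{0<..<a}. ennreal (\<phi> y) \<partial>lebesgue) < top" if "0 < a" for a
  proof -
    have "integrable lebesgue (\<lambda>y. indicator {0<..<a} y *\<^sub>R \<phi> y)"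
      using \<phi> that by (auto simp: nontrivial_weight_def weight_def set_integrable_def)
    then have "(\<integral>\<^sup>+y. ennreal (norm (indicator {0<..<a} y *\<^sub>R \<phi> y)) \<partial>lebesgue) < top"
      by (simp add: integrable_iff_bounded)
    moreover have "ennreal (norm (indicator {0<..<a} y *\<^sub>R \<phi> y)) = ennreal (\<phi> y) * indicator {0<..<a} y" for y
      using pos[of y] by (auto simp: indicator_def)
    ultimately show ?thesis by simp
  qed
  have "(\<integral>\<^sup>+y\<in>{0<..<t}. ennreal (\<phi> y) \<partial>lebesgue) \<noteq> 0"
  proof
    assume "(\<integral>\<^sup>+y\<in>{0<..<t}. ennreal (\<phi> y) \<partial>lebesgue) = 0"
    then have "AE y in lebesgue. ennreal (indicator {0<..<t} y *\<^sub>R \<phi> y) = 0"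
      unfolding ind using meas[OF t] by (subst (asm) nn_integral_0_iff_AE) auto
    then have "AE y in lebesgue. y \<notin> {0<..<t}"
    proof eventually_elim
      case (elim y)
      show ?case
      proof
        assume y: "y \<in> {0<..<t}"
        then have "\<phi> y \<le> 0" using elim by (simp add: ennreal_eq_0_iff)
        then show False using pos[of y] y by simp
      qed
    qed
    then show False using not_AE_notin_Ioo[OF t] by simp
  qed
  then show "0 < fundamental p w t"
    unfolding fundamental_eq[OF w eq t] by (simp add: zero_less_iff_neq_zero)
  \<comment> \<open>For \<open>t < y \<le> 1\<close> the power is at most \<open>t powr - p\<close>.
    The interval \<open>(0, 2)\<close> also covers \<open>y = 1\<close>, and its overlap with
    \<open>{1<..}\<close> is harmless in an upper bound.\<close>
  have "(\<integral>\<^sup>+y\<in>{t<..}. ennreal (\<phi> y * y powr (- p)) \<partial>lborel)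
    \<le> (\<integral>\<^sup>+y. ennreal (t powr - p) * (ennreal (\<phi> y) * indicator {0<..<2} y) +
         ennreal (\<phi> y * y powr (- p)) * indicator {1<..} y \<partial>lborel)"
  proof (rule nn_integral_mono)
    fix y :: real
    have "ennreal (\<phi> y * y powr - p) \<le> ennreal (t powr - p) * ennreal (\<phi> y)" if "t < y"
    proof -
      have "y powr - p \<le> t powr - p" using that t p by (intro powr_mono2') auto
      then have "\<phi> y * y powr - p \<le> t powr - p * \<phi> y"
        using pos[of y] that t by (subst mult.commute) (intro mult_right_mono, auto)
      then show ?thesis by (simp only: ennreal_mult'[symmetric, OF powr_ge_zero] ennreal_leI)
    qed
    then show "ennreal (\<phi> y * y powr (- p)) * indicator {t<..} y
      \<le> ennreal (t powr - p) * (ennreal (\<phi> y) * indicator {0<..<2} y) +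
         ennreal (\<phi> y * y powr (- p)) * indicator {1<..} y"
      using t by (cases "1 < y") (auto simp: indicator_def)
  qed
  also have "\<dots> = (\<integral>\<^sup>+y. ennreal (t powr - p) * (ennreal (w y) * indicator {0<..<2} y) +
         ennreal (w y * y powr (- p)) * indicator {1<..} y \<partial>lborel)"
  proof (rule nn_integral_cong_AE)
    show "AE y in lborel. ennreal (t powr - p) * (ennreal (\<phi> y) * indicator {0<..<2} y) +
         ennreal (\<phi> y * y powr (- p)) * indicator {1<..} y
       = ennreal (t powr - p) * (ennreal (w y) * indicator {0<..<2} y) +
         ennreal (w y * y powr (- p)) * indicator {1<..} y"
      using eq by eventually_elim (auto simp: indicator_def)
  qed
  also have "\<dots> = ennreal (t powr - p) * (\<integral>\<^sup>+y\<in>{0<..<2}. ennreal (w y) \<partial>lborel) +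
         (\<integral>\<^sup>+y\<in>{1<..}. ennreal (w y * y powr (- p)) \<partial>lborel)"
    using w by (subst nn_integral_add) (auto simp: nn_integral_cmult)
  also have "(\<integral>\<^sup>+y\<in>{0<..<2}. ennreal (w y) \<partial>lborel) = (\<integral>\<^sup>+y\<in>{0<..<2}. ennreal (\<phi> y) \<partial>lborel)"
  proof (rule nn_integral_cong_AE)
    show "AE y in lborel. ennreal (w y) * indicator {0<..<2} y = ennreal (\<phi> y) * indicator {0<..<2} y"
      using eq by eventually_elim (auto simp: indicator_def)
  qed
  also have "(\<integral>\<^sup>+y\<in>{1<..}. ennreal (w y * y powr (- p)) \<partial>lborel)
      = (\<integral>\<^sup>+y\<in>{1<..}. ennreal (\<phi> y * y powr (- p)) \<partial>lborel)"
  proof (rule nn_integral_cong_AE)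
    show "AE y in lborel. ennreal (w y * y powr (- p)) * indicator {1<..} y
        = ennreal (\<phi> y * y powr (- p)) * indicator {1<..} y"
      using eq by eventually_elim (auto simp: indicator_def)
  qed
  also have "ennreal (t powr - p) * (\<integral>\<^sup>+y\<in>{0<..<2}. ennreal (\<phi> y) \<partial>lborel) +
         (\<integral>\<^sup>+y\<in>{1<..}. ennreal (\<phi> y * y powr (- p)) \<partial>lborel) < top"
    using fin[of 2] \<phi> by (simp add: nontrivial_weight_def nn_integral_completion ennreal_mult_less_top)
  finally show "fundamental p w t < top"
    unfolding fundamental_eq[OF w eq t] using fin[OF t]
    by (simp add: nn_integral_completion ennreal_mult_less_top)
qed

section \<open>Norms of characteristic functions\<close>

lemma indicator_M_plus: "indicator {0<..<t} \<in> M_plus"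
  unfolding M_plus_def by (intro measurable_restrict_space1 borel_measurable_indicator) simp

lemma rearr_indicator:
  assumes t: "0 < t" and x: "0 < x"
  shows "rearr (indicator {0<..<t}) x = indicator {0<..<t} x"
proof -
  have distr: "distr_fn (indicator {0<..<t}) l = (if l < 1 then ennreal t else 0)" for l
  proof -
    have "{x\<in>{0<..}. ennreal l < indicator {0<..<t} x} = (if l < 1 then {0<..<t} else {})"
      by (auto simp: indicator_def ennreal_less_one_iff split: if_splits)
    then show ?thesis using t by (simp add: distr_fn_def)
  qed
  show ?thesis
  proof (cases "x < t")
    case True
    then have "{l. 0 < l \<and> distr_fn (indicator {0<..<t}) l \<le> ennreal x} = {1..}"
      using x t by (auto simp: distr split: if_splits)
    moreover have "(INF l\<in>{1..}. ennreal l) = 1"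
      by (intro antisym INF_lower2[of 1] INF_greatest) auto
    ultimately show ?thesis using True x by (simp add: rearr_distr_fn)
  next
    case False
    \<comment> \<open>Only positive levels compete in the infimum, so the value 0 is approached
      through arbitrarily small \<open>e\<close>.\<close>
    have "rearr (indicator {0<..<t}) x \<le> ennreal e" if "0 < e" for e
      unfolding rearr_distr_fn using that False x by (intro INF_lower) (auto simp: distr ennreal_leI)
    then have "rearr (indicator {0<..<t}) x \<le> 0"
      using ennreal_le_epsilon[of 0 "rearr (indicator {0<..<t}) x"] by simp
    then show ?thesis using False by simp
  qed
qed

lemma maximal_rearr_indicator:
  assumes t: "0 < t" and y: "0 < y"
  shows "maximal_rearr (indicator {0<..<t}) y = ennreal (min 1 (t / y))"
proof -
  have "(\<integral>\<^sup>+x\<in>{0<..<y}. rearr (indicator {0<..<t}) x \<partial>lborel) = (\<integral>\<^sup>+x. indicator {0<..<min y t} x \<partial>lborel)"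
    by (intro nn_integral_cong) (auto simp: indicator_def rearr_indicator[OF t])
  also have "\<dots> = ennreal (min y t)" using t y by simp
  finally show ?thesis
    unfolding maximal_rearr_lborel using t y by (auto simp: divide_ennreal min_def)
qed

lemma rho_indicator:
  assumes "AE y in lborel. 0 < y \<longrightarrow> \<phi> y = w y" and t: "0 < t"
  shows "rho p \<phi> (indicator {0<..<t}) = epow (fundamental p w t) (1 / p)"
proof -
  have "(\<integral>\<^sup>+y\<in>{0<..}. epow (maximal_rearr (indicator {0<..<t}) y) p * ennreal (w y) \<partial>lborel) = fundamental p w t"
    unfolding fundamental_def
  proof (rule nn_integral_cong)
    fix y
    show "epow (maximal_rearr (indicator {0<..<t}) y) p * ennreal (w y) * indicator {0<..} y
      = ennreal (min 1 (t / y) powr p) * ennreal (w y) * indicator {0<..} y"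
    proof (cases "0 < y")
      case True
      then have "0 \<le> min 1 (t / y)" using t by simp
      then show ?thesis using maximal_rearr_indicator[OF t True] by (simp add: epow_ennreal)
    qed simp
  qed
  then show ?thesis by (simp add: rho_borel_version[OF assms(1)])
qed

lemma epow_divide:
  assumes "0 < y" "y < top"
  shows "epow (x / y) p = epow x p / epow y p"
proof -
  obtain r where r: "y = ennreal r" "0 \<le> r" using assms by (cases y) auto
  then have "0 < r" using assms by simp
  then have y: "epow y p \<noteq> 0" "epow y p \<noteq> top" using r by (simp_all add: epow_ennreal)
  have "x = x / y * y" using assms by (simp add: ennreal_divide_times)
  then have "epow x p = epow (x / y) p * epow y p" by (metis epow_mult)
  then show ?thesis using y by (simp add: ennreal_mult_divide_eq)
qed

theorem theoremB:
  fixes p :: real and \<phi> :: "real \<Rightarrow> real"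
  assumes "1 < p" and "nontrivial_weight p \<phi>"
  shows "(\<forall>s>0. dilation_fn (rho p \<phi>) s =
            (SUP f\<in>admissible (rho p \<phi>).
               rho p \<phi> (\<lambda>t. rearr f (t / s)) / rho p \<phi> (rearr f)))
       \<and> (\<exists>C::real. C > 0 \<and> (\<forall>s>0.
            dilation_fn (rho p \<phi>) s
              \<le> ennreal C * (SUP t\<in>{0<..}. epow (weight_quotient p \<phi> s t) (1 / p))
          \<and> (SUP t\<in>{0<..}. epow (weight_quotient p \<phi> s t) (1 / p))
              \<le> ennreal C * dilation_fn (rho p \<phi>) s))"
proof -
  note p = assms(1)
  have "weight \<phi>" using assms(2) by (simp add: nontrivial_weight_def)
  then obtain w where w: "w \<in> borel_measurable borel" "AE y in lborel. 0 < y \<longrightarrow> \<phi> y = w y"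
    by (rule weight_borel_version)
  have "0 < p" using p by simp
  note pos_fin = fundamental_pos_finite[OF assms(2) this w]
  note quot = weight_quotient_fundamental[OF w]
  \<comment> \<open>\<open>C0\<close> is the constant for \<open>p\<close>-th powers; the 1 in the
    maximum serves the inequality coming from characteristic functions.\<close>
  define C0 where "C0 = 2 powr p * (2 * (p + 1) / p)"
  define C where "C = max 1 (C0 powr (1 / p))"
  have C0: "0 \<le> C0" using p by (simp add: C0_def)
  have upper: "dilation_fn (rho p \<phi>) s \<le> ennreal C * (SUP t\<in>{0<..}. epow (weight_quotient p \<phi> s t) (1 / p))"
    (is "_ \<le> _ * ?S") if s: "0 < s" for s
    unfolding dilation_fn_def
  proof (rule SUP_least)
    fix f assume "f \<in> admissible (rho p \<phi>)"
    then have f: "f \<in> M_plus" by (simp add: admissible_def)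
    \<comment> \<open>The \<open>p\<close>-th power of the supremum, possibly infinite, plays the
      role of \<open>K\<close>.\<close>
    have K: "fundamental p w (s * y) \<le> epow ?S p * fundamental p w y" if y: "0 < y" for y
    proof -
      have "epow (weight_quotient p \<phi> s y) (1 / p) \<le> ?S" using y by (intro SUP_upper) simp
      then have "weight_quotient p \<phi> s y \<le> epow ?S p" using p by (simp add: epow_le_iff)
      then have "fundamental p w (s * y) / fundamental p w y * fundamental p w y \<le> epow ?S p * fundamental p w y"
        unfolding quot[OF s y] by (rule mult_right_mono) simp
      then show ?thesis using pos_fin[OF y] by (simp add: ennreal_divide_times ennreal_divide_self)
    qed
    have "rho p \<phi> (\<lambda>t. f (t / s)) \<le> epow (ennreal C0 * epow ?S p *
        (\<integral>\<^sup>+t\<in>{0<..}. epow (maximal_rearr f t) p * ennreal (w t) \<partial>lborel)) (1 / p)"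
      unfolding rho_borel_version[OF w(2)] C0_def
      using p by (intro epow_mono dilation_norm_le f s w K) auto
    also have "\<dots> = ennreal (C0 powr (1 / p)) * ?S * rho p \<phi> f"
      using p C0 by (simp add: epow_mult epow_epow epow_ennreal rho_borel_version[OF w(2)])
    also have "\<dots> \<le> ennreal C * ?S * rho p \<phi> f"
      by (intro mult_right_mono ennreal_leI) (auto simp: C_def)
    finally have le: "rho p \<phi> (\<lambda>t. f (t / s)) \<le> ennreal C * ?S * rho p \<phi> f" .
    show "rho p \<phi> (\<lambda>t. f (t / s)) / rho p \<phi> f \<le> ennreal C * ?S"
    \<comment> \<open>If the norm of \<open>f\<close> is 0, the bound makes the numerator 0 as well,
      and \<open>0 / 0 = 0\<close> in \<open>ennreal\<close>.\<close>
    proof (cases "rho p \<phi> f = 0")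
      case True
      then show ?thesis using le by simp
    next
      case False
      then show ?thesis using le
        by (intro divide_le_posI_ennreal) (auto simp: zero_less_iff_neq_zero mult.commute)
    qed
  qed
  have lower: "(SUP t\<in>{0<..}. epow (weight_quotient p \<phi> s t) (1 / p)) \<le> ennreal C * dilation_fn (rho p \<phi>) s"
    if s: "0 < s" for s
  proof -
    \<comment> \<open>The characteristic function of \<open>(0, t)\<close> is admissible and its
      dilate is that of \<open>(0, s * t)\<close>, so this quotient competes in the
      supremum.\<close>
    have "epow (weight_quotient p \<phi> s t) (1 / p) \<le> dilation_fn (rho p \<phi>) s" if t: "0 < t" for t
    proof -
      have st: "0 < s * t" using s t by simp
      have scale: "(\<lambda>x. indicator {0<..<t} (x / s)) = (indicator {0<..<s * t} :: real \<Rightarrow> ennreal)"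
        using s by (auto simp: fun_eq_iff indicator_def zero_less_divide_iff field_simps)
      have "\<not> (AE x in lebesgue. 0 < x \<longrightarrow> indicator {0<..<t} x = (0::ennreal))"
      proof
        assume "AE x in lebesgue. 0 < x \<longrightarrow> indicator {0<..<t} x = (0::ennreal)"
        then have "AE x in lebesgue. x \<notin> {0<..<t}"
          by eventually_elim (auto simp: indicator_def split: if_splits)
        then show False using not_AE_notin_Ioo[OF t] by simp
      qed
      moreover have "rho p \<phi> (indicator {0<..<t}) < top"
        unfolding rho_indicator[OF w(2) t] using pos_fin(2)[OF t]
        by (cases "fundamental p w t") (auto simp: epow_ennreal)
      ultimately have "indicator {0<..<t} \<in> admissible (rho p \<phi>)"
        by (simp add: admissible_def indicator_M_plus)
      then have "rho p \<phi> (\<lambda>x. indicator {0<..<t} (x / s)) / rho p \<phi> (indicator {0<..<t})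
          \<le> dilation_fn (rho p \<phi>) s"
        unfolding dilation_fn_def by (rule SUP_upper)
      then show ?thesis
        unfolding scale rho_indicator[OF w(2) t] rho_indicator[OF w(2) st] quot[OF s t]
          epow_divide[OF pos_fin[OF t]] .
    qed
    then have "(SUP t\<in>{0<..}. epow (weight_quotient p \<phi> s t) (1 / p)) \<le> 1 * dilation_fn (rho p \<phi>) s"
      by (auto intro: SUP_least)
    also have "\<dots> \<le> ennreal C * dilation_fn (rho p \<phi>) s"
      by (intro mult_right_mono) (auto simp: C_def)
    finally show ?thesis .
  qed
  have "C > 0" by (simp add: C_def)
  then show ?thesis using upper lower dilation_fn_eq_rearr by blast
qed

end
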